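(* Let $\mathit{Var}$ be finite and $M$ a commutative complete quantale. Let $R$ be a renaming-stable rule set, let $(\mathcal V,\iota,\{h_\sigma\})$ be a type object over $R$, let $C$ be a command, and let $\Delta^{\mathcal V}_C:\mathit{Var}\to\mathcal V_1$ be any postcondition $R$-derivable in $\mathcal V$ from $\iota$, i.e. such that $1\vdash_{\mathcal V}\iota\{C\}\Delta^{\mathcal V}_C$ is $R$-derivable. Then for every $\sigma:\mathit{Var}\to M_1$ and every $W\subseteq\mathit{Var}$, $h_\sigma\bigl(\bigotimes_{w\in W}\Delta^{\mathcal V}_C(w)\bigr)$ is above the greatest lower bound of the joint bounds for $W$ that $R$ derives in $M$ from $\sigma$ directly, i.e. $$h_\sigma\Bigl(\bigotimes_{w\in W}\Delta^{\mathcal V}_C(w)\Bigr)\sqsupseteq\bigwedge\Bigl\{\bigotimes_{w\in W}\Gamma'(w)\;\Big|\;1\vdash_M\sigma\{C\}\Gamma'\ \text{is }R\text{-derivable}\Bigr\}.$$ If $R$ is the rule set $F_1$ given in the context, this greatest lower bound is $\alpha^{\mathbb N}_\sigma(\mathbb J^{\mathbb N}_W)$.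
   Context: Quantales. A commutative complete quantale $\langle M,\sqsubseteq,\bigvee,\otimes,1\rangle$ is a complete lattice with a commutative monoid $(\otimes,1)$ such that $\otimes$ distributes over arbitrary joins. $M_1=\{m\mid 1\sqsubseteq m\}$. $m^0=1$, $m^n$ is the $n$-fold tensor power, $m^*=\bigvee_{n\ge0}m^n$. Empty tensors are $1$. Language. Commands: $\mathsf{skip}$, $x:=E$, $C_1;C_2$, $\mathsf{if}\;E\;C_1\;C_2$, $\mathsf{while}\;E\;C$; $\mathit{fv}(E)$ is the set of variables of $E$, $\mathit{asgn}(C)$ the set of variables assigned in $C$. Judgements have the form $p\vdash_M\Gamma\{C\}\Gamma'$ with $p\in M_1$, $\Gamma,\Gamma':\mathit{Var}\to M_1$, for each commutative complete quantale $M$. A rule set $R$ determines a notion of derivable judgement for each $M$. $R$ is renaming-stable if for all commutative complete quantales $M,M'$ and every $f:M_1\to M_1'$ that is monotone, lax monoidal ($f(a)\otimes f(b)\sqsubseteq f(a\otimes b)$) and lax unital ($1\sqsubseteq f(1)$), $R$-derivability of $p\vdash_M\Gamma\{C\}\Gamma'$ implies $R$-derivability of $f(p)\vdash_{M'}f\circ\Gamma\{C\}f\circ\Gamma'$. A type object over $R$ (with target $M$) is a commutative complete quantale $\mathcal V$, a map $\iota:\mathit{Var}\to\mathcal V_1$ and, for every $\sigma:\mathit{Var}\to M_1$, a monotone, lax monoidal, lax unital map $h_\sigma:\mathcal V\to M$ with $h_\sigma(\iota(v))\sqsupseteq\sigma(v)$ for all $v$; derivations in $\mathcal V$ use $R$.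 Rule set $F_1$, with $t_E(\Gamma)=\bigotimes_{v\in\mathit{fv}(E)}\Gamma(v)$: (Skip) $p\vdash\Gamma\{\mathsf{skip}\}\Gamma$. (Assign) $p\vdash\Gamma\{x:=E\}\Gamma[x\mapsto p\otimes t_E(\Gamma)]$. (Seq) from $p\vdash\Gamma\{C_1\}\Gamma''$ and $p\vdash\Gamma''\{C_2\}\Gamma'$ infer $p\vdash\Gamma\{C_1;C_2\}\Gamma'$. (If) with $t=t_E(\Gamma)$, from $p\otimes t\vdash\Gamma\{C_i\}\Gamma_i'$ ($i=1,2$) infer $p\vdash\Gamma\{\mathsf{if}\;E\;C_1\;C_2\}\Gamma'$ where $\Gamma'(x)=t\otimes(\Gamma_1'(x)\vee\Gamma_2'(x))$ for $x\in\mathit{asgn}(C_1)\cup\mathit{asgn}(C_2)$ and $\Gamma'(x)=\Gamma(x)$ otherwise. (While) with $t=t_E(\Gamma)$, from $p\otimes t\vdash\Gamma\{C\}\Gamma$ infer $p\vdash\Gamma\{\mathsf{while}\;E\;C\}\Gamma^\dagger$ where $\Gamma^\dagger(x)=t^*\otimes\Gamma(x)$ for $x\in\mathit{asgn}(C)$ and $\Gamma^\dagger(x)=\Gamma(x)$ otherwise. (Sub) from $p\vdash\Gamma\{C\}\Gamma_1'$, $p'\sqsubseteq p$, $\Gamma'\sqsubseteq\Gamma$, $\Gamma_1'\sqsubseteq\Gamma_2'$ infer $p'\vdash\Gamma'\{C\}\Gamma_2'$. Multiset object. $\mathcal U_{\mathbb N}$ is the set of downsets of $(\mathbb N^{\mathit{Var}},\le)$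 ordered by inclusion, with $\bigvee=\bigcup$, $\mathbb M\otimes\mathbb N={\downarrow}\{m+n\mid m\in\mathbb M,n\in\mathbb N\}$, $1={\downarrow}0$; generators $\hat v={\downarrow}e_v$ ($e_v$ the unit vector at $v$). $\alpha^{\mathbb N}_\sigma(\mathbb M)=\bigvee_{m\in\mathbb M}\bigotimes_v\sigma(v)^{m(v)}$. $\mathbb J^{\mathbb N}_W=\bigotimes_{w\in W}\Delta^{\mathbb N}_C(w)$, where $\Delta^{\mathbb N}_C=\mathcal A^C_{\mathcal U_{\mathbb N}}(1,v\mapsto\hat v)$ and $\mathcal A^C_M(p,\Gamma)$ is defined by recursion on $C$: $\Gamma$ for $\mathsf{skip}$; $\Gamma[x\mapsto p\otimes t_E(\Gamma)]$ for $x:=E$; $\mathcal A^{C_2}(p,\mathcal A^{C_1}(p,\Gamma))$ for $C_1;C_2$; for $\mathsf{if}\;E\;C_1\;C_2$, with $t=t_E(\Gamma)$, $\Gamma_i'=\mathcal A^{C_i}(p\otimes t,\Gamma)$, the environment $x\mapsto t\otimes(\Gamma_1'(x)\vee\Gamma_2'(x))$ for $x\in\mathit{asgn}(C_1)\cup\mathit{asgn}(C_2)$ and $x\mapsto\Gamma(x)$ otherwise; for $\mathsf{while}\;E\;C$, with $\Gamma^*$ the least fixed point of $\Theta\mapsto\Gamma\vee\mathcal A^C(p\otimes t_E(\Theta),\Theta)$ (environments valued in $M_1$) and $t=t_E(\Gamma^* )$, the environment $x\mapsto t^*\otimes\Gamma^*(x)$ for $x\in\mathit{asgn}(C)$ and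 $x\mapsto\Gamma^*(x)$ otherwise.
   Formalization: For the first inequality, R-derivability is additionally assumed closed under the rule (Sub); without it the claim fails, e.g. for R deriving only judgements with constant preconditions, where a nonconstant σ yields no bounds. *)

theory Defs
  imports "HOL-Algebra.FiniteProduct" "HOL-Algebra.Complete_Lattice"
begin

section \<open>Commutative complete quantales\<close>

text \<open>Quantales are explicit structures with carriers in a universe type, because renaming
  stability and type objects relate several quantales inside one statement.\<close>

record 'a quantale = "'a gorder" +
  qmult :: "'a \<Rightarrow> 'a \<Rightarrow> 'a"
  qone :: 'a

abbreviation tmon :: "'a quantale \<Rightarrow> 'a monoid"
  where "tmon Q \<equiv> \<lparr>carrier = carrier Q, mult = qmult Q, one = qone Q\<rparr>"

locale comm_quantale =
  fixes Q :: "'a quantale"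
  assumes complete_lattice: "complete_lattice Q"
    and comm_monoid: "comm_monoid (tmon Q)"
    and mult_Sup_distrib: "a \<in> carrier Q \<Longrightarrow> A \<subseteq> carrier Q \<Longrightarrow>
      a \<otimes>\<^bsub>tmon Q\<^esub> \<Squnion>\<^bsub>Q\<^esub>A = \<Squnion>\<^bsub>Q\<^esub>((\<lambda>x. a \<otimes>\<^bsub>tmon Q\<^esub> x) ` A)"

definition above_one :: "'a quantale \<Rightarrow> 'a set"
  where "above_one Q = {m \<in> carrier Q. \<one>\<^bsub>tmon Q\<^esub> \<sqsubseteq>\<^bsub>Q\<^esub> m}"

definition qstar :: "'a quantale \<Rightarrow> 'a \<Rightarrow> 'a"
  where "qstar Q m = \<Squnion>\<^bsub>Q\<^esub>(range (\<lambda>n::nat. m [^]\<^bsub>tmon Q\<^esub> n))"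

text \<open>Lax maps defined on a subset \<open>A\<close> of the source (used with \<open>A\<close> the whole carrier and
  with \<open>A\<close> the elements above the unit).\<close>

definition lax_map :: "'a quantale \<Rightarrow> 'a set \<Rightarrow> 'b quantale \<Rightarrow> 'b set \<Rightarrow> ('a \<Rightarrow> 'b) \<Rightarrow> bool"
  where "lax_map Q A Q' B f \<longleftrightarrow>
    f \<in> A \<rightarrow> B \<and>
    (\<forall>a\<in>A. \<forall>b\<in>A. a \<sqsubseteq>\<^bsub>Q\<^esub> b \<longrightarrow> f a \<sqsubseteq>\<^bsub>Q'\<^esub> f b) \<and>
    (\<forall>a\<in>A. \<forall>b\<in>A. f a \<otimes>\<^bsub>tmon Q'\<^esub> f b \<sqsubseteq>\<^bsub>Q'\<^esub> f (a \<otimes>\<^bsub>tmon Q\<^esub> b)) \<and>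
    \<one>\<^bsub>tmon Q'\<^esub> \<sqsubseteq>\<^bsub>Q'\<^esub> f \<one>\<^bsub>tmon Q\<^esub>"

definition envs :: "'a quantale \<Rightarrow> ('v \<Rightarrow> 'a) set"
  where "envs Q = {\<Gamma>. \<forall>x. \<Gamma> x \<in> above_one Q}"

definition env_le :: "'a quantale \<Rightarrow> ('v \<Rightarrow> 'a) \<Rightarrow> ('v \<Rightarrow> 'a) \<Rightarrow> bool"
  where "env_le Q \<Gamma> \<Gamma>' \<longleftrightarrow> (\<forall>x. \<Gamma> x \<sqsubseteq>\<^bsub>Q\<^esub> \<Gamma>' x)"

definition env_order :: "'a quantale \<Rightarrow> ('v \<Rightarrow> 'a) gorder"
  where "env_order Q = \<lparr>carrier = envs Q, eq = (=), le = env_le Q\<rparr>"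


section \<open>Commands, judgements and rule sets\<close>

text \<open>Expressions enter only through their sets of variables; they form an arbitrary type
  \<open>'e\<close>, and \<open>fv :: 'e \<Rightarrow> 'v set\<close> is a parameter.\<close>

datatype ('v, 'e) com =
    Skip
  | Assign 'v 'e
  | Seq "('v, 'e) com" "('v, 'e) com"
  | Cond 'e "('v, 'e) com" "('v, 'e) com"
  | While 'e "('v, 'e) com"

primrec asgn :: "('v, 'e) com \<Rightarrow> 'v set"
  where
    "asgn Skip = {}"
  | "asgn (Assign x E) = {x}"
  | "asgn (Seq C1 C2) = asgn C1 \<union> asgn C2"
  | "asgn (Cond E C1 C2) = asgn C1 \<union> asgn C2"
  | "asgn (While E C) = asgn C"

datatype ('v, 'e, 'a) judgement =
  Judgement 'a "'v \<Rightarrow> 'a" "('v, 'e) com" "'v \<Rightarrow> 'a"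

primrec judgement_in :: "'a quantale \<Rightarrow> ('v, 'e, 'a) judgement \<Rightarrow> bool"
  where "judgement_in M (Judgement p \<Gamma> C \<Gamma>') \<longleftrightarrow> p \<in> above_one M \<and> \<Gamma> \<in> envs M \<and> \<Gamma>' \<in> envs M"

text \<open>A rule set gives, for every quantale, a set of rule instances (premises, conclusion).\<close>

type_synonym ('v, 'e, 'a) rule_set =
  "'a quantale \<Rightarrow> (('v, 'e, 'a) judgement set \<times> ('v, 'e, 'a) judgement) set"

inductive derivable ::
  "('v, 'e, 'a) rule_set \<Rightarrow> 'a quantale \<Rightarrow> ('v, 'e, 'a) judgement \<Rightarrow> bool"
  for R M
  where
    "(P, J) \<in> R M \<Longrightarrow> judgement_in M J \<Longrightarrow> (\<And>J'. J' \<in> P \<Longrightarrow> derivable R M J') \<Longrightarrow> derivable R M J"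

definition renaming_stable :: "('v, 'e, 'a) rule_set \<Rightarrow> bool"
  where "renaming_stable R \<longleftrightarrow>
    (\<forall>M M' f. comm_quantale M \<longrightarrow> comm_quantale M' \<longrightarrow>
      lax_map M (above_one M) M' (above_one M') f \<longrightarrow>
      (\<forall>p \<Gamma> C \<Gamma>'. derivable R M (Judgement p \<Gamma> C \<Gamma>') \<longrightarrow>
        derivable R M' (Judgement (f p) (f \<circ> \<Gamma>) C (f \<circ> \<Gamma>'))))"

text \<open>Weakening, i.e. the rule (Sub) of \<open>F1\<close> below, is admissible. This does not follow from
  renaming stability; see \<open>bound_fails_without_sub\<close>.\<close>

definition admits_sub :: "('v, 'e, 'a) rule_set \<Rightarrow> bool"
  where "admits_sub R \<longleftrightarrow>
    (\<forall>M p p' \<Gamma> \<Gamma>' C \<Gamma>1 \<Gamma>2. comm_quantale M \<longrightarrow>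
      derivable R M (Judgement p \<Gamma> C \<Gamma>1) \<longrightarrow>
      p' \<in> above_one M \<longrightarrow> \<Gamma>' \<in> envs M \<longrightarrow> \<Gamma>2 \<in> envs M \<longrightarrow>
      p' \<sqsubseteq>\<^bsub>M\<^esub> p \<longrightarrow> env_le M \<Gamma>' \<Gamma> \<longrightarrow> env_le M \<Gamma>1 \<Gamma>2 \<longrightarrow>
      derivable R M (Judgement p' \<Gamma>' C \<Gamma>2))"

definition type_object ::
  "'a quantale \<Rightarrow> 'a quantale \<Rightarrow> ('v \<Rightarrow> 'a) \<Rightarrow> (('v \<Rightarrow> 'a) \<Rightarrow> 'a \<Rightarrow> 'a) \<Rightarrow> bool"
  where "type_object M V \<iota> h \<longleftrightarrow>
    comm_quantale V \<and> \<iota> \<in> envs V \<and>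
    (\<forall>\<sigma>\<in>envs M. lax_map V (carrier V) M (carrier M) (h \<sigma>) \<and>
      (\<forall>v. \<sigma> v \<sqsubseteq>\<^bsub>M\<^esub> h \<sigma> (\<iota> v)))"

definition joint_bounds ::
  "('v, 'e, 'a) rule_set \<Rightarrow> 'a quantale \<Rightarrow> ('v, 'e) com \<Rightarrow> ('v \<Rightarrow> 'a) \<Rightarrow> 'v set \<Rightarrow> 'a set"
  where "joint_bounds R M C \<sigma> W =
    {\<Otimes>\<^bsub>tmon M\<^esub>w\<in>W. \<Gamma>' w | \<Gamma>'. derivable R M (Judgement \<one>\<^bsub>tmon M\<^esub> \<sigma> C \<Gamma>')}"


section \<open>The rule set \<open>F1\<close>\<close>

definition guard :: "('e \<Rightarrow> 'v set) \<Rightarrow> 'a quantale \<Rightarrow> 'e \<Rightarrow> ('v \<Rightarrow> 'a) \<Rightarrow> 'a"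
  where "guard fv M E \<Gamma> = (\<Otimes>\<^bsub>tmon M\<^esub>v\<in>fv E. \<Gamma> v)"

definition if_env :: "'a quantale \<Rightarrow> 'v set \<Rightarrow> 'a \<Rightarrow> ('v \<Rightarrow> 'a) \<Rightarrow> ('v \<Rightarrow> 'a) \<Rightarrow> ('v \<Rightarrow> 'a) \<Rightarrow> 'v \<Rightarrow> 'a"
  where "if_env M X t \<Gamma> \<Gamma>1 \<Gamma>2 =
    (\<lambda>x. if x \<in> X then t \<otimes>\<^bsub>tmon M\<^esub> (\<Gamma>1 x \<squnion>\<^bsub>M\<^esub> \<Gamma>2 x) else \<Gamma> x)"

definition while_env :: "'a quantale \<Rightarrow> 'v set \<Rightarrow> 'a \<Rightarrow> ('v \<Rightarrow> 'a) \<Rightarrow> 'v \<Rightarrow> 'a"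
  where "while_env M X t \<Gamma> = (\<lambda>x. if x \<in> X then qstar M t \<otimes>\<^bsub>tmon M\<^esub> \<Gamma> x else \<Gamma> x)"

inductive_set F1 ::
  "('e \<Rightarrow> 'v set) \<Rightarrow> 'a quantale \<Rightarrow> (('v, 'e, 'a) judgement set \<times> ('v, 'e, 'a) judgement) set"
  for fv :: "'e \<Rightarrow> 'v set" and M :: "'a quantale"
  where
    Skip: "({}, Judgement p \<Gamma> Skip \<Gamma>) \<in> F1 fv M"
  | Assign: "({}, Judgement p \<Gamma> (Assign x E) (\<Gamma>(x := p \<otimes>\<^bsub>tmon M\<^esub> guard fv M E \<Gamma>))) \<in> F1 fv M"
  | Seq: "({Judgement p \<Gamma> C1 \<Gamma>'', Judgement p \<Gamma>'' C2 \<Gamma>'}, Judgement p \<Gamma> (Seq C1 C2) \<Gamma>') \<in> F1 fv M"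
  | Cond: "t = guard fv M E \<Gamma> \<Longrightarrow>
      ({Judgement (p \<otimes>\<^bsub>tmon M\<^esub> t) \<Gamma> C1 \<Gamma>1, Judgement (p \<otimes>\<^bsub>tmon M\<^esub> t) \<Gamma> C2 \<Gamma>2},
        Judgement p \<Gamma> (Cond E C1 C2) (if_env M (asgn C1 \<union> asgn C2) t \<Gamma> \<Gamma>1 \<Gamma>2)) \<in> F1 fv M"
  | While: "t = guard fv M E \<Gamma> \<Longrightarrow>
      ({Judgement (p \<otimes>\<^bsub>tmon M\<^esub> t) \<Gamma> C \<Gamma>},
        Judgement p \<Gamma> (While E C) (while_env M (asgn C) t \<Gamma>)) \<in> F1 fv M"
  | Sub: "p' \<sqsubseteq>\<^bsub>M\<^esub> p \<Longrightarrow> env_le M \<Gamma>' \<Gamma> \<Longrightarrow> env_le M \<Gamma>1 \<Gamma>2 \<Longrightarrow>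
      ({Judgement p \<Gamma> C \<Gamma>1}, Judgement p' \<Gamma>' C \<Gamma>2) \<in> F1 fv M"

text \<open>The postcondition transformer. Its loop case uses the least fixed point in the complete
  lattice of environments with values above the unit.\<close>

primrec post ::
  "('e \<Rightarrow> 'v set) \<Rightarrow> 'a quantale \<Rightarrow> ('v, 'e) com \<Rightarrow> 'a \<Rightarrow> ('v \<Rightarrow> 'a) \<Rightarrow> ('v \<Rightarrow> 'a)"
  where
    "post fv M Skip = (\<lambda>p \<Gamma>. \<Gamma>)"
  | "post fv M (Assign x E) = (\<lambda>p \<Gamma>. \<Gamma>(x := p \<otimes>\<^bsub>tmon M\<^esub> guard fv M E \<Gamma>))"
  | "post fv M (Seq C1 C2) = (\<lambda>p \<Gamma>. post fv M C2 p (post fv M C1 p \<Gamma>))"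
  | "post fv M (Cond E C1 C2) = (\<lambda>p \<Gamma>.
      let t = guard fv M E \<Gamma> in
      if_env M (asgn C1 \<union> asgn C2) t \<Gamma>
        (post fv M C1 (p \<otimes>\<^bsub>tmon M\<^esub> t) \<Gamma>) (post fv M C2 (p \<otimes>\<^bsub>tmon M\<^esub> t) \<Gamma>))"
  | "post fv M (While E C) = (\<lambda>p \<Gamma>.
      let \<Gamma>s = LFP\<^bsub>env_order M\<^esub>
        (\<lambda>\<Theta> x. \<Gamma> x \<squnion>\<^bsub>M\<^esub> post fv M C (p \<otimes>\<^bsub>tmon M\<^esub> guard fv M E \<Theta>) \<Theta> x)
      in while_env M (asgn C) (guard fv M E \<Gamma>s) \<Gamma>s)"


section \<open>The multiset object\<close>

text \<open>Elements of \<open>\<nat>\<^sup>V\<^sup>a\<^sup>r\<close> are functions \<open>'v \<Rightarrow> nat\<close> with the pointwise order.\<close>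

definition down :: "('v \<Rightarrow> nat) set \<Rightarrow> ('v \<Rightarrow> nat) set"
  where "down A = {k. \<exists>m\<in>A. k \<le> m}"

definition UNat :: "('v \<Rightarrow> nat) set quantale"
  where "UNat = \<lparr>carrier = {D. \<forall>m\<in>D. \<forall>k\<le>m. k \<in> D}, eq = (=), le = (\<subseteq>),
    qmult = (\<lambda>D D'. down {(\<lambda>v. m v + n v) | m n. m \<in> D \<and> n \<in> D'}),
    qone = down {\<lambda>v. 0}\<rparr>"

definition gen :: "'v \<Rightarrow> ('v \<Rightarrow> nat) set"
  where "gen v = down {(\<lambda>_. 0)(v := 1)}"

definition alphaN :: "'a quantale \<Rightarrow> ('v \<Rightarrow> 'a) \<Rightarrow> ('v \<Rightarrow> nat) set \<Rightarrow> 'a"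
  where "alphaN M \<sigma> D = \<Squnion>\<^bsub>M\<^esub>((\<lambda>m. \<Otimes>\<^bsub>tmon M\<^esub>v\<in>UNIV. \<sigma> v [^]\<^bsub>tmon M\<^esub> m v) ` D)"

definition DeltaN :: "('e \<Rightarrow> 'v set) \<Rightarrow> ('v, 'e) com \<Rightarrow> 'v \<Rightarrow> ('v \<Rightarrow> nat) set"
  where "DeltaN fv C = post fv UNat C \<one>\<^bsub>tmon UNat\<^esub> gen"

definition JN :: "('e \<Rightarrow> 'v set) \<Rightarrow> ('v, 'e) com \<Rightarrow> 'v set \<Rightarrow> ('v \<Rightarrow> nat) set"
  where "JN fv C W = (\<Otimes>\<^bsub>tmon UNat\<^esub>w\<in>W. DeltaN fv C w)"

text \<open>The order of \<open>UNat\<close> determines its joins; they are unions.\<close>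

lemma Sup_UNat:
  assumes "A \<subseteq> carrier (UNat :: ('v \<Rightarrow> nat) set quantale)"
  shows "least UNat (\<Union>A) (Upper UNat A)" "\<Squnion>\<^bsub>UNat\<^esub>A = \<Union>A"
proof -
  show *: "least UNat (\<Union>A) (Upper UNat A)"
    using assms by (fastforce simp: least_def Upper_def UNat_def)
  show "\<Squnion>\<^bsub>UNat\<^esub>A = \<Union>A"
    unfolding Lattice.sup_def
  proof (rule some_equality)
    fix s assume "least UNat s (Upper UNat A)"
    with * have "s \<sqsubseteq>\<^bsub>UNat\<^esub> \<Union>A" "\<Union>A \<sqsubseteq>\<^bsub>UNat\<^esub> s"
      unfolding least_def by blast+
    then show "s = \<Union>A" by (simp add: UNat_def)
  qed (rule *)
qed

lemma qmult_UNat_iff: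
  "k \<in> qmult UNat D D' \<longleftrightarrow> (\<exists>m\<in>D. \<exists>n\<in>D'. \<forall>v. k v \<le> m v + n v)"
  by (auto simp: UNat_def down_def le_fun_def)

lemma qone_UNat: "qone UNat = {\<lambda>v. 0}"
  by (auto simp: UNat_def down_def le_fun_def)

lemma carrier_UNat: "carrier UNat = {D. \<forall>m\<in>D. \<forall>k\<le>m. k \<in> D}"
  by (simp add: UNat_def)

lemma comm_quantale_UNat: "comm_quantale (UNat :: ('v \<Rightarrow> nat) set quantale)" (is "comm_quantale ?U")
proof (rule comm_quantale.intro)
  interpret partial_order ?U
    by standard (auto simp: UNat_def)
  show "complete_lattice ?U"
  proof (rule complete_latticeI)
    fix A assume A: "A \<subseteq> carrier ?U"
    show "\<exists>s. least ?U s (Upper ?U A)"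
      using Sup_UNat(1)[OF A] by blast
    have "greatest ?U (\<Inter>A) (Lower ?U A)"
      using A by (fastforce simp: greatest_def Lower_def UNat_def)
    then show "\<exists>i. greatest ?U i (Lower ?U A)" by blast
  qed
  have closed: "qmult ?U D D' \<in> carrier ?U" for D D'
    unfolding carrier_UNat
    by (auto simp: qmult_UNat_iff le_fun_def) (meson order_trans)
  have "qmult ?U D D' \<subseteq> qmult ?U D' D" for D D'
  proof
    fix k assume "k \<in> qmult ?U D D'"
    then obtain m n where "m \<in> D" "n \<in> D'" "\<forall>v. k v \<le> n v + m v"
      by (auto simp: qmult_UNat_iff add.commute)
    then show "k \<in> qmult ?U D' D"
      unfolding qmult_UNat_iff by (intro bexI)
  qed
  then have comm: "qmult ?U D D' = qmult ?U D' D" for D D'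
    by (simp add: subset_antisym)
  have unit: "qmult ?U (qone ?U) D = D" if "D \<in> carrier ?U" for D
  proof
    show "qmult ?U (qone ?U) D \<subseteq> D"
      using that by (auto simp: qmult_UNat_iff qone_UNat carrier_UNat le_fun_def)
    show "D \<subseteq> qmult ?U (qone ?U) D"
      by (auto simp: qmult_UNat_iff qone_UNat)
  qed
  have assoc: "qmult ?U (qmult ?U D1 D2) D3 = qmult ?U D1 (qmult ?U D2 D3)" for D1 D2 D3
  proof -
    have "k \<in> qmult ?U (qmult ?U D1 D2) D3 \<longleftrightarrow>
      (\<exists>a\<in>D1. \<exists>b\<in>D2. \<exists>c\<in>D3. \<forall>v. k v \<le> a v + b v + c v)" (is "_ \<longleftrightarrow> ?P k") for k
    proof
      assume "k \<in> qmult ?U (qmult ?U D1 D2) D3"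
      then obtain m a b c where "a \<in> D1" "b \<in> D2" "c \<in> D3"
        "\<forall>v. m v \<le> a v + b v" "\<forall>v. k v \<le> m v + c v"
        by (auto simp: qmult_UNat_iff)
      moreover from this have "\<forall>v. k v \<le> a v + b v + c v"
        by (meson add_le_mono1 order_trans)
      ultimately show "?P k" by blast
    next
      assume "?P k"
      then obtain a b c where "a \<in> D1" "b \<in> D2" "c \<in> D3" "\<forall>v. k v \<le> a v + b v + c v"
        by blast
      moreover from this have "(\<lambda>v. a v + b v) \<in> qmult ?U D1 D2"
        by (auto simp: qmult_UNat_iff)
      ultimately show "k \<in> qmult ?U (qmult ?U D1 D2) D3"
        unfolding qmult_UNat_iff[of k] by (intro bexI[of _ "\<lambda>v. a v + b v"] bexI[of _ c])
    qed
    moreover have "k \<in> qmult ?U D1 (qmult ?U D2 D3) \<longleftrightarrow>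
      (\<exists>a\<in>D1. \<exists>b\<in>D2. \<exists>c\<in>D3. \<forall>v. k v \<le> a v + b v + c v)" (is "_ \<longleftrightarrow> ?P k") for k
    proof
      assume "k \<in> qmult ?U D1 (qmult ?U D2 D3)"
      then obtain m a b c where "a \<in> D1" "b \<in> D2" "c \<in> D3"
        "\<forall>v. m v \<le> b v + c v" "\<forall>v. k v \<le> a v + m v"
        by (auto simp: qmult_UNat_iff)
      moreover from this have "\<forall>v. k v \<le> a v + b v + c v"
        by (metis add.assoc add_le_mono order_refl order_trans)
      ultimately show "?P k" by blast
    next
      assume "?P k"
      then obtain a b c where "a \<in> D1" "b \<in> D2" "c \<in> D3" "\<forall>v. k v \<le> a v + b v + c v"
        by blast
      moreover from this have "(\<lambda>v. b v + c v) \<in> qmult ?U D2 D3"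
        by (auto simp: qmult_UNat_iff)
      ultimately show "k \<in> qmult ?U D1 (qmult ?U D2 D3)"
        unfolding qmult_UNat_iff[of k]
        by (intro bexI[of _ a] bexI[of _ "\<lambda>v. b v + c v"]) (simp_all add: add.assoc)
    qed
    ultimately show ?thesis by blast
  qed
  have one: "qone ?U \<in> carrier ?U"
    by (auto simp: qone_UNat carrier_UNat le_fun_def)
  show "comm_monoid (tmon ?U)"
    by (rule comm_monoidI) (simp_all add: closed one unit assoc, rule comm)
  fix a :: "('v \<Rightarrow> nat) set" and A
  assume A: "A \<subseteq> carrier ?U"
  have "(\<lambda>x. qmult ?U a x) ` A \<subseteq> carrier ?U"
    using closed by blast
  then show "a \<otimes>\<^bsub>tmon ?U\<^esub> \<Squnion>\<^bsub>?U\<^esub>A = \<Squnion>\<^bsub>?U\<^esub>((\<lambda>x. a \<otimes>\<^bsub>tmon ?U\<^esub> x) ` A)"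
    using A by (simp add: Sup_UNat(2)) (auto simp: qmult_UNat_iff, blast+)
qed


section \<open>Admissibility of (Sub)\<close>

lemma admits_sub_F1: "admits_sub (F1 fv :: ('v, 'e, 'a) rule_set)"
  unfolding admits_sub_def
proof (intro allI impI)
  fix M :: "'a quantale" and p p' :: 'a and \<Gamma> \<Gamma>' \<Gamma>1 \<Gamma>2 :: "'v \<Rightarrow> 'a" and C :: "('v, 'e) com"
  assume "derivable (F1 fv) M (Judgement p \<Gamma> C \<Gamma>1)" "p' \<in> above_one M" "\<Gamma>' \<in> envs M" "\<Gamma>2 \<in> envs M"
    and "p' \<sqsubseteq>\<^bsub>M\<^esub> p" "env_le M \<Gamma>' \<Gamma>" "env_le M \<Gamma>1 \<Gamma>2"
  then show "derivable (F1 fv) M (Judgement p' \<Gamma>' C \<Gamma>2)"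
    by (intro derivable.intros[OF F1.Sub]) auto
qed

text \<open>Without (Sub), the bound for type objects fails. The rule set below is renaming-stable
  but derives judgements only from constant preconditions, so the greatest lower bound is the
  top element when \<open>\<sigma>\<close> is not constant.\<close>

lemma bound_fails_without_sub:
  fixes C :: "(bool, 'e) com"
  defines "R \<equiv> (\<lambda>_. {({}, Judgement p (\<lambda>_. c) C (\<lambda>_. p)) | p c. True})
      :: (bool, 'e, (bool \<Rightarrow> nat) set) rule_set"
    and "\<iota> \<equiv> (\<lambda>_. UNIV) :: bool \<Rightarrow> (bool \<Rightarrow> nat) set"
    and "\<Delta> \<equiv> (\<lambda>_. qone UNat) :: bool \<Rightarrow> (bool \<Rightarrow> nat) set"
    and "\<sigma> \<equiv> (\<lambda>b. if b then UNIV else qone UNat) :: bool \<Rightarrow> (bool \<Rightarrow> nat) set"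
  shows "renaming_stable R" "\<sigma> \<in> envs UNat"
    "type_object UNat UNat \<iota> (\<lambda>_ D. D)"
    "derivable R UNat (Judgement \<one>\<^bsub>tmon UNat\<^esub> \<iota> C \<Delta>)"
    "\<not> \<Sqinter>\<^bsub>UNat\<^esub>(joint_bounds R UNat C \<sigma> {}) \<sqsubseteq>\<^bsub>UNat\<^esub> (\<Otimes>\<^bsub>tmon UNat\<^esub>w\<in>{}. \<Delta> w)"
proof -
  have R: "derivable R M (Judgement p \<Gamma> C' \<Gamma>') \<longleftrightarrow>
      C' = C \<and> (\<exists>c. \<Gamma> = (\<lambda>_. c)) \<and> \<Gamma>' = (\<lambda>_. p) \<and> judgement_in M (Judgement p \<Gamma> C' \<Gamma>')"
    for M p \<Gamma> C' \<Gamma>'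
    by (subst derivable.simps) (auto simp: R_def)
  show "renaming_stable R"
    unfolding renaming_stable_def R
    by (auto simp: envs_def lax_map_def fun_eq_iff)
  have one: "qone UNat \<in> above_one (UNat :: (bool \<Rightarrow> nat) set quantale)"
    and top: "UNIV \<in> above_one (UNat :: (bool \<Rightarrow> nat) set quantale)"
    by (auto simp: above_one_def qone_UNat carrier_UNat le_fun_def) (auto simp: UNat_def)
  show "\<sigma> \<in> envs UNat"
    using one top by (simp add: envs_def \<sigma>_def)
  have U: "comm_quantale (UNat :: (bool \<Rightarrow> nat) set quantale)"
    by (rule comm_quantale_UNat)
  interpret U: comm_monoid "tmon (UNat :: (bool \<Rightarrow> nat) set quantale)"
    by (rule comm_quantale.comm_monoid[OF U])
  have le: "D \<sqsubseteq>\<^bsub>UNat\<^esub> D' \<longleftrightarrow> D \<subseteq> D'" for D D' :: "(bool \<Rightarrow> nat) set"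
    by (simp add: UNat_def)
  show "type_object UNat UNat \<iota> (\<lambda>_ D. D)"
    using U top by (auto simp: type_object_def envs_def \<iota>_def lax_map_def le)
  show "derivable R UNat (Judgement \<one>\<^bsub>tmon UNat\<^esub> \<iota> C \<Delta>)"
    using one top by (auto simp: R envs_def \<iota>_def \<Delta>_def)
  have "\<sigma> True \<noteq> \<sigma> False"
    by (auto simp: \<sigma>_def qone_UNat) (metis UNIV_I one_neq_zero singletonD)
  then have "joint_bounds R UNat C \<sigma> {} = {}"
    by (auto simp: joint_bounds_def R)
  moreover have "\<Sqinter>\<^bsub>UNat\<^esub>{} = (UNIV :: (bool \<Rightarrow> nat) set)"
    unfolding Lattice.inf_def
    by (rule some_equality) (auto simp: greatest_def Lower_def UNat_def)
  moreover have "\<not> (UNIV :: (bool \<Rightarrow> nat) set) \<subseteq> {\<lambda>v. 0}"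
    by (metis UNIV_I one_neq_zero singletonD subsetD)
  moreover have "(\<Otimes>\<^bsub>tmon UNat\<^esub>w\<in>{}. \<Delta> w) = {\<lambda>v. 0}"
    unfolding U.finprod_empty by (simp add: qone_UNat)
  ultimately show "\<not> \<Sqinter>\<^bsub>UNat\<^esub>(joint_bounds R UNat C \<sigma> {}) \<sqsubseteq>\<^bsub>UNat\<^esub> (\<Otimes>\<^bsub>tmon UNat\<^esub>w\<in>{}. \<Delta> w)"
    by (simp only: le simp_thms)
qed

end

(* The transformer "post" computes the least F1-derivable postcondition: it is derivable by
   structural induction, the loop case using that the least fixed point is an invariant, and it is
   below every derivable postcondition by induction on derivations. Hence the greatest lower bound
   of the joint bounds is attained at "post". Evaluation of multisets in an environment sigma is a
   quantale homomorphism from UNat to M that sends the generators to sigma, and homomorphisms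
   commute with "post", so the bound is the image of the joint multiset bound.

   For a type object, rename the given derivation along h sigma and weaken with (Sub); its
   joint bound lies below the value of h sigma at the tensor because h sigma is lax monoidal. *)

theory Submission
  imports Defs
begin

section \<open>Commutative complete quantales\<close>

sublocale comm_quantale \<subseteq> lat: complete_lattice Q
  by (rule complete_lattice)

sublocale comm_quantale \<subseteq> mon: comm_monoid "tmon Q"
  by (rule comm_monoid)

context comm_quantale
begin

text \<open>Unfolding the selectors of \<open>tmon Q\<close> turns the monoid facts into facts about
  \<open>qmult Q\<close> and \<open>qone Q\<close>, the normal form used throughout. Powers and
  finite tensors remain those of \<open>tmon Q\<close>.\<close>

lemmas qmult_closed [simp] = mon.m_closed [simplified]
lemmas qone_closed [simp] = mon.one_closed [simplified]
lemmas qmult_comm = mon.m_comm [simplified]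
lemmas qmult_one_left [simp] = mon.l_one [simplified]
lemmas qmult_one_right [simp] = mon.r_one [simplified]
lemmas qpow_closed [simp] = mon.nat_pow_closed [simplified]
lemmas finprod_closed [simp] = mon.finprod_closed [simplified]
lemmas qmult_Sup = mult_Sup_distrib [simplified]
lemmas le_trans = lat.le_trans
lemmas le_refl [simp] = lat.le_refl

lemma Sup_closed [simp]: "A \<subseteq> carrier Q \<Longrightarrow> \<Squnion>\<^bsub>Q\<^esub>A \<in> carrier Q"
  by (rule lat.weak.sup_closed)

lemma Sup_upper: "x \<in> A \<Longrightarrow> A \<subseteq> carrier Q \<Longrightarrow> x \<sqsubseteq>\<^bsub>Q\<^esub> \<Squnion>\<^bsub>Q\<^esub>A"
  by (rule lat.weak.sup_upper)

lemma Sup_least: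
  "A \<subseteq> carrier Q \<Longrightarrow> z \<in> carrier Q \<Longrightarrow> (\<And>x. x \<in> A \<Longrightarrow> x \<sqsubseteq>\<^bsub>Q\<^esub> z) \<Longrightarrow> \<Squnion>\<^bsub>Q\<^esub>A \<sqsubseteq>\<^bsub>Q\<^esub> z"
  by (rule lat.weak.sup_least)

lemma Sup_mono:
  assumes "B \<subseteq> carrier Q" "A \<subseteq> carrier Q"
    and "\<And>x. x \<in> A \<Longrightarrow> \<exists>y\<in>B. x \<sqsubseteq>\<^bsub>Q\<^esub> y"
  shows "\<Squnion>\<^bsub>Q\<^esub>A \<sqsubseteq>\<^bsub>Q\<^esub> \<Squnion>\<^bsub>Q\<^esub>B"
  using assms by (intro Sup_least Sup_closed) (meson Sup_upper Sup_closed le_trans subsetD)+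

lemma Sup_pair_absorb:
  assumes "a \<in> carrier Q" "b \<in> carrier Q" "a \<sqsubseteq>\<^bsub>Q\<^esub> b"
  shows "\<Squnion>\<^bsub>Q\<^esub>{a, b} = b"
  using assms by (intro lat.le_antisym Sup_least Sup_upper) auto

text \<open>Monotonicity is a consequence of distributivity: for b below c the join of {b, c} is c,
  so the product of a and c is the join of the products of a with b and with c.\<close>

lemma qmult_mono_right:
  assumes "a \<in> carrier Q" "b \<in> carrier Q" "c \<in> carrier Q" "b \<sqsubseteq>\<^bsub>Q\<^esub> c"
  shows "qmult Q a b \<sqsubseteq>\<^bsub>Q\<^esub> qmult Q a c"
proof -
  have "qmult Q a c = \<Squnion>\<^bsub>Q\<^esub>{qmult Q a b, qmult Q a c}"
    using qmult_Sup[of a "{b, c}"] assms by (simp add: Sup_pair_absorb)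
  then show ?thesis
    using assms by (metis Sup_upper insertI1 empty_subsetI insert_subset qmult_closed)
qed

lemma qmult_mono:
  assumes "a \<in> carrier Q" "b \<in> carrier Q" "c \<in> carrier Q" "d \<in> carrier Q"
    and "a \<sqsubseteq>\<^bsub>Q\<^esub> b" "c \<sqsubseteq>\<^bsub>Q\<^esub> d"
  shows "qmult Q a c \<sqsubseteq>\<^bsub>Q\<^esub> qmult Q b d"
proof (rule le_trans)
  show "qmult Q a c \<sqsubseteq>\<^bsub>Q\<^esub> qmult Q a d"
    using assms by (intro qmult_mono_right)
  show "qmult Q a d \<sqsubseteq>\<^bsub>Q\<^esub> qmult Q b d"
    using assms qmult_mono_right[of d a b] by (simp add: qmult_comm)
qed (use assms in auto)

text \<open>Two joins are multiplied out by distributing over one argument after the other, which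
  leaves only products of members to be bounded.\<close>

lemma Sup_qmult_Sup_le:
  assumes "A \<subseteq> carrier Q" "B \<subseteq> carrier Q" "z \<in> carrier Q"
    and le: "\<And>a b. a \<in> A \<Longrightarrow> b \<in> B \<Longrightarrow> qmult Q a b \<sqsubseteq>\<^bsub>Q\<^esub> z"
  shows "qmult Q (\<Squnion>\<^bsub>Q\<^esub>A) (\<Squnion>\<^bsub>Q\<^esub>B) \<sqsubseteq>\<^bsub>Q\<^esub> z"
proof -
  have "qmult Q (\<Squnion>\<^bsub>Q\<^esub>A) b \<sqsubseteq>\<^bsub>Q\<^esub> z" if b: "b \<in> B" for b
  proof -
    have bc: "b \<in> carrier Q"
      using b assms by auto
    \<comment> \<open>Distributivity is given for joins in the right argument, so the factors are
      swapped first.\<close>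
    have "qmult Q (\<Squnion>\<^bsub>Q\<^esub>A) b = \<Squnion>\<^bsub>Q\<^esub>((\<lambda>a. qmult Q b a) ` A)"
      using bc assms by (simp add: qmult_comm[of _ b] qmult_Sup)
    also have "\<dots> \<sqsubseteq>\<^bsub>Q\<^esub> z"
      using bc b assms(1,3) le by (intro Sup_least) (auto simp: qmult_comm[of b] subsetD)
    finally show ?thesis .
  qed
  then have "\<Squnion>\<^bsub>Q\<^esub>((\<lambda>b. qmult Q (\<Squnion>\<^bsub>Q\<^esub>A) b) ` B) \<sqsubseteq>\<^bsub>Q\<^esub> z"
    using assms(1-3) by (intro Sup_least) (auto simp: subsetD)
  then show ?thesis
    using assms by (simp add: qmult_Sup)
qed

lemma finprod_mono:
  assumes "finite A" "f \<in> A \<rightarrow> carrier Q" "g \<in> A \<rightarrow> carrier Q"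
    and "\<And>i. i \<in> A \<Longrightarrow> f i \<sqsubseteq>\<^bsub>Q\<^esub> g i"
  shows "finprod (tmon Q) f A \<sqsubseteq>\<^bsub>Q\<^esub> finprod (tmon Q) g A"
  using assms by (induction A rule: finite_induct) (auto simp: Pi_iff intro!: qmult_mono)

lemma qpow_mono:
  assumes "a \<in> carrier Q" "b \<in> carrier Q" "a \<sqsubseteq>\<^bsub>Q\<^esub> b"
  shows "a [^]\<^bsub>tmon Q\<^esub> (n::nat) \<sqsubseteq>\<^bsub>Q\<^esub> b [^]\<^bsub>tmon Q\<^esub> n"
  using assms by (induction n) (auto intro!: qmult_mono)

lemma qstar_closed [simp]: "a \<in> carrier Q \<Longrightarrow> qstar Q a \<in> carrier Q"
  unfolding qstar_def by (intro Sup_closed) auto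

lemma qstar_mono:
  assumes "a \<in> carrier Q" "b \<in> carrier Q" "a \<sqsubseteq>\<^bsub>Q\<^esub> b"
  shows "qstar Q a \<sqsubseteq>\<^bsub>Q\<^esub> qstar Q b"
  unfolding qstar_def using assms by (intro Sup_mono) (auto intro: qpow_mono)

lemma join_mono:
  assumes "a \<in> carrier Q" "b \<in> carrier Q" "c \<in> carrier Q" "d \<in> carrier Q"
    and "a \<sqsubseteq>\<^bsub>Q\<^esub> b" "c \<sqsubseteq>\<^bsub>Q\<^esub> d"
  shows "a \<squnion>\<^bsub>Q\<^esub> c \<sqsubseteq>\<^bsub>Q\<^esub> b \<squnion>\<^bsub>Q\<^esub> d"
  using assms unfolding join_def by (intro Sup_mono) auto

section \<open>Elements above the unit\<close>

lemma above_one_closed: "a \<in> above_one Q \<Longrightarrow> a \<in> carrier Q"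
  by (simp add: above_one_def)

lemma above_oneI: "a \<in> carrier Q \<Longrightarrow> qone Q \<sqsubseteq>\<^bsub>Q\<^esub> a \<Longrightarrow> a \<in> above_one Q"
  by (simp add: above_one_def)

lemma above_one_le: "a \<in> above_one Q \<Longrightarrow> qone Q \<sqsubseteq>\<^bsub>Q\<^esub> a"
  by (simp add: above_one_def)

lemma above_one_up: "a \<in> above_one Q \<Longrightarrow> b \<in> carrier Q \<Longrightarrow> a \<sqsubseteq>\<^bsub>Q\<^esub> b \<Longrightarrow> b \<in> above_one Q"
  by (meson above_oneI above_one_closed above_one_le le_trans qone_closed)

lemma above_one_qone [simp]: "qone Q \<in> above_one Q"
  by (simp add: above_one_def)

lemma above_one_qmult [simp]:
  assumes "a \<in> above_one Q" "b \<in> above_one Q"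
  shows "qmult Q a b \<in> above_one Q"
  using assms qmult_mono[of "qone Q" a "qone Q" b] by (simp add: above_one_def)

lemma above_one_join [simp]:
  assumes "a \<in> above_one Q" "b \<in> above_one Q"
  shows "a \<squnion>\<^bsub>Q\<^esub> b \<in> above_one Q"
  using assms by (simp add: above_one_up[OF assms(1)] lat.join_left above_one_closed)

text \<open>Products of elements above the unit stay above it. Over an infinite index set
  \<open>finprod\<close> has the unit as its default value, which covers that case too.\<close>

lemma above_one_finprod:
  assumes "f \<in> A \<rightarrow> above_one Q"
  shows "finprod (tmon Q) f A \<in> above_one Q"
  using assms by (induction A rule: infinite_finite_induct) (auto simp: Pi_iff above_one_closed)

lemma above_one_qpow [simp]: "a \<in> above_one Q \<Longrightarrow> a [^]\<^bsub>tmon Q\<^esub> (n::nat) \<in> above_one Q"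
  by (induction n) auto

text \<open>Each further factor lies above the unit, so multiplying by it can only increase a
  power.\<close>

lemma qpow_mono_exp:
  assumes a: "a \<in> above_one Q" and "m \<le> n"
  shows "a [^]\<^bsub>tmon Q\<^esub> (m::nat) \<sqsubseteq>\<^bsub>Q\<^esub> a [^]\<^bsub>tmon Q\<^esub> n"
  using assms(2)
proof (induction n rule: dec_induct)
  case (step n)
  have ac: "a \<in> carrier Q"
    using a by (rule above_one_closed)
  have "a [^]\<^bsub>tmon Q\<^esub> n \<sqsubseteq>\<^bsub>Q\<^esub> a [^]\<^bsub>tmon Q\<^esub> Suc n"
    using qmult_mono_right[of "a [^]\<^bsub>tmon Q\<^esub> n" "qone Q" a] ac above_one_le[OF a] by simp
  with step.IH ac show ?case
    by (meson le_trans qpow_closed)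
qed (use a in \<open>simp add: above_one_closed\<close>)

lemma above_one_qstar [simp]:
  assumes "a \<in> above_one Q"
  shows "qstar Q a \<in> above_one Q"
proof (rule above_oneI)
  have sub: "range (\<lambda>n::nat. a [^]\<^bsub>tmon Q\<^esub> n) \<subseteq> carrier Q"
    using above_one_closed[OF assms] by (simp add: image_subset_iff)
  show "qone Q \<sqsubseteq>\<^bsub>Q\<^esub> qstar Q a"
    unfolding qstar_def by (rule Sup_upper[OF _ sub], rule range_eqI[of _ _ 0]) simp
  show "qstar Q a \<in> carrier Q"
    using above_one_closed[OF assms] by simp
qed

section \<open>Environments and their complete lattice\<close>

lemma envs_above_one: "\<Gamma> \<in> envs Q \<Longrightarrow> \<Gamma> x \<in> above_one Q"
  by (simp add: envs_def)

lemma envs_closed: "\<Gamma> \<in> envs Q \<Longrightarrow> \<Gamma> x \<in> carrier Q"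
  by (simp add: envs_above_one above_one_closed)

lemma env_le_refl [simp]: "\<Gamma> \<in> envs Q \<Longrightarrow> env_le Q \<Gamma> \<Gamma>"
  by (simp add: env_le_def envs_closed)

lemma env_le_trans:
  "env_le Q \<Gamma> \<Theta> \<Longrightarrow> env_le Q \<Theta> \<Psi> \<Longrightarrow> \<Gamma> \<in> envs Q \<Longrightarrow> \<Theta> \<in> envs Q \<Longrightarrow> \<Psi> \<in> envs Q \<Longrightarrow> env_le Q \<Gamma> \<Psi>"
  unfolding env_le_def by (meson envs_closed le_trans)

lemma env_le_antisym:
  "env_le Q \<Gamma> \<Theta> \<Longrightarrow> env_le Q \<Theta> \<Gamma> \<Longrightarrow> \<Gamma> \<in> envs Q \<Longrightarrow> \<Theta> \<in> envs Q \<Longrightarrow> \<Gamma> = \<Theta>"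
  unfolding env_le_def by (intro ext lat.le_antisym) (simp_all add: envs_closed)

text \<open>A greatest environment and meets of nonempty families suffice. Both are computed
  pointwise, and a meet of values above the unit is above the unit because the unit is one of their
  lower bounds. Meets are more convenient than joins here: the pointwise empty join is the bottom of
  \<open>Q\<close>, which need not lie above the unit.\<close>

lemma complete_lattice_env_order: "complete_lattice (env_order Q :: ('v \<Rightarrow> 'a) gorder)"
proof -
  let ?L = "env_order Q :: ('v \<Rightarrow> 'a) gorder"
  interpret L: partial_order ?L
    by standard (simp_all add: env_order_def env_le_antisym, rule env_le_trans)
  show ?thesis
  proof (rule L.complete_lattice_criterion1)
    have "\<Squnion>\<^bsub>Q\<^esub>(carrier Q) \<in> above_one Q"
      by (rule above_oneI) (simp_all add: Sup_upper)
    then have "(\<lambda>_. \<Squnion>\<^bsub>Q\<^esub>(carrier Q)) \<in> envs Q"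
      by (simp add: envs_def)
    then have "greatest ?L (\<lambda>_. \<Squnion>\<^bsub>Q\<^esub>(carrier Q)) (carrier ?L)"
      by (simp add: greatest_def env_order_def env_le_def Sup_upper envs_closed)
    then show "\<exists>g. greatest ?L g (carrier ?L)"
      by blast
  next
    fix A assume A: "A \<subseteq> carrier ?L" "A \<noteq> {}"
    then have AE: "\<Gamma> \<in> envs Q" if "\<Gamma> \<in> A" for \<Gamma>
      using that by (auto simp: env_order_def)
    define i where "i = (\<lambda>x. \<Sqinter>\<^bsub>Q\<^esub>((\<lambda>\<Gamma>. \<Gamma> x) ` A))"
    have sub: "(\<lambda>\<Gamma>. \<Gamma> x) ` A \<subseteq> carrier Q" for x
      using AE by (simp add: image_subset_iff envs_closed)
    have greatest: "z \<sqsubseteq>\<^bsub>Q\<^esub> i x" if "z \<in> carrier Q" "\<And>\<Gamma>. \<Gamma> \<in> A \<Longrightarrow> z \<sqsubseteq>\<^bsub>Q\<^esub> \<Gamma> x" for z x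
      unfolding i_def using that by (intro lat.weak.inf_greatest sub) auto
    have i: "i \<in> envs Q"
      unfolding envs_def
    proof (intro CollectI allI above_oneI)
      show "i x \<in> carrier Q" for x
        by (simp add: i_def sub)
      show "qone Q \<sqsubseteq>\<^bsub>Q\<^esub> i x" for x
        by (rule greatest) (simp_all add: above_one_le envs_above_one AE)
    qed
    have "greatest ?L i (Lower ?L A)"
    proof (rule greatest_LowerI)
      fix \<Gamma> assume "\<Gamma> \<in> A"
      then show "i \<sqsubseteq>\<^bsub>?L\<^esub> \<Gamma>"
        unfolding env_order_def env_le_def i_def by (simp add: lat.weak.inf_lower[OF sub])
    next
      fix \<Gamma> assume "\<Gamma> \<in> Lower ?L A"
      then have "\<Gamma> \<in> envs Q" "\<And>\<Theta>. \<Theta> \<in> A \<Longrightarrow> env_le Q \<Gamma> \<Theta>"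
        using A(1) by (auto simp: Lower_def env_order_def)
      then show "\<Gamma> \<sqsubseteq>\<^bsub>?L\<^esub> i"
        by (simp add: env_order_def env_le_def greatest envs_closed)
    qed (use A i in \<open>simp_all add: env_order_def\<close>)
    then show "\<exists>i. greatest ?L i (Lower ?L A)"
      by blast
  qed
qed


section \<open>The postcondition transformer\<close>

lemma guard_above_one: "\<Gamma> \<in> envs Q \<Longrightarrow> guard fv Q E \<Gamma> \<in> above_one Q"
  unfolding guard_def by (rule above_one_finprod) (simp add: envs_above_one)

lemma guard_closed: "\<Gamma> \<in> envs Q \<Longrightarrow> guard fv Q E \<Gamma> \<in> carrier Q"
  by (rule above_one_closed[OF guard_above_one])

lemma guard_mono:
  fixes fv :: "'e \<Rightarrow> 'v::finite set"
  assumes "\<Gamma> \<in> envs Q" "\<Theta> \<in> envs Q" "env_le Q \<Gamma> \<Theta>"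
  shows "guard fv Q E \<Gamma> \<sqsubseteq>\<^bsub>Q\<^esub> guard fv Q E \<Theta>"
  unfolding guard_def using assms
  by (intro finprod_mono) (simp_all add: envs_closed env_le_def)

lemma if_env_envs:
  assumes "t \<in> above_one Q" "\<Gamma> \<in> envs Q" "\<Gamma>1 \<in> envs Q" "\<Gamma>2 \<in> envs Q"
  shows "if_env Q X t \<Gamma> \<Gamma>1 \<Gamma>2 \<in> envs Q"
  using assms unfolding if_env_def by (auto simp: envs_def)

lemma if_env_mono:
  assumes "t \<in> carrier Q" "\<Gamma> \<in> envs Q" "\<Gamma>1 \<in> envs Q" "\<Gamma>2 \<in> envs Q"
    and "t' \<in> carrier Q" "\<Gamma>' \<in> envs Q" "\<Gamma>1' \<in> envs Q" "\<Gamma>2' \<in> envs Q"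
    and "t \<sqsubseteq>\<^bsub>Q\<^esub> t'" "env_le Q \<Gamma> \<Gamma>'" "env_le Q \<Gamma>1 \<Gamma>1'" "env_le Q \<Gamma>2 \<Gamma>2'"
  shows "env_le Q (if_env Q X t \<Gamma> \<Gamma>1 \<Gamma>2) (if_env Q X t' \<Gamma>' \<Gamma>1' \<Gamma>2')"
  using assms unfolding if_env_def env_le_def
  by (simp add: qmult_mono join_mono envs_closed)

lemma while_env_envs:
  assumes "t \<in> above_one Q" "\<Gamma> \<in> envs Q"
  shows "while_env Q X t \<Gamma> \<in> envs Q"
  using assms unfolding while_env_def by (auto simp: envs_def)

lemma while_env_mono:
  assumes "t \<in> carrier Q" "\<Gamma> \<in> envs Q" "t' \<in> carrier Q" "\<Gamma>' \<in> envs Q"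
    and "t \<sqsubseteq>\<^bsub>Q\<^esub> t'" "env_le Q \<Gamma> \<Gamma>'"
  shows "env_le Q (while_env Q X t \<Gamma>) (while_env Q X t' \<Gamma>')"
  using assms unfolding while_env_def env_le_def
  by (simp add: qmult_mono qstar_mono envs_closed)

end

section \<open>Loop invariants as least fixed points, and monotonicity of the transformer\<close>

definition loop_step ::
  "('e \<Rightarrow> 'v set) \<Rightarrow> 'a quantale \<Rightarrow> 'e \<Rightarrow> ('v, 'e) com \<Rightarrow> 'a \<Rightarrow> ('v \<Rightarrow> 'a) \<Rightarrow> ('v \<Rightarrow> 'a) \<Rightarrow> 'v \<Rightarrow> 'a"
  where "loop_step fv Q E C p \<Gamma> \<Theta> =
    (\<lambda>x. \<Gamma> x \<squnion>\<^bsub>Q\<^esub> post fv Q C (qmult Q p (guard fv Q E \<Theta>)) \<Theta> x)"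

text \<open>The least loop invariant above \<Gamma>: the smallest environment above \<Gamma> that
  the body preserves when it runs under \<open>p\<close> tensored with the guard of that same
  environment.\<close>

definition loop_inv ::
  "('e \<Rightarrow> 'v set) \<Rightarrow> 'a quantale \<Rightarrow> 'e \<Rightarrow> ('v, 'e) com \<Rightarrow> 'a \<Rightarrow> ('v \<Rightarrow> 'a) \<Rightarrow> 'v \<Rightarrow> 'a"
  where "loop_inv fv Q E C p \<Gamma> = LFP\<^bsub>env_order Q\<^esub> (loop_step fv Q E C p \<Gamma>)"

lemma post_While:
  "post fv Q (While E C) p \<Gamma> =
    while_env Q (asgn C) (guard fv Q E (loop_inv fv Q E C p \<Gamma>)) (loop_inv fv Q E C p \<Gamma>)"
  by (simp add: loop_inv_def loop_step_def[abs_def] Let_def)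

context comm_quantale
begin

text \<open>\<open>LFP\<close> is the meet of all pre-fixed environments, and a complete lattice has
  this meet for every operator, monotone or not.\<close>

lemma loop_inv_envs:
  fixes fv :: "'e \<Rightarrow> 'v set"
  shows "loop_inv fv Q E C p \<Gamma> \<in> envs Q"
proof -
  interpret L: complete_lattice "env_order Q :: ('v \<Rightarrow> 'a) gorder"
    by (rule complete_lattice_env_order)
  show ?thesis
    unfolding loop_inv_def using L.weak.LFP_closed[of "loop_step fv Q E C p \<Gamma>"]
    by (simp add: env_order_def)
qed

text \<open>Together with \<open>loop_inv_greatest\<close> this describes the invariant as a meet of
  pre-fixed environments. Neither fact relies on monotonicity of the loop step, so both are
  available inside the proof of \<open>post_mono\<close>, from which that monotonicity is
  obtained.\<close>

lemma loop_inv_lowerbound: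
  fixes fv :: "'e \<Rightarrow> 'v set"
  assumes "\<Theta> \<in> envs Q" "env_le Q (loop_step fv Q E C p \<Gamma> \<Theta>) \<Theta>"
  shows "env_le Q (loop_inv fv Q E C p \<Gamma>) \<Theta>"
proof -
  interpret L: complete_lattice "env_order Q :: ('v \<Rightarrow> 'a) gorder"
    by (rule complete_lattice_env_order)
  show ?thesis
    using L.weak.LFP_lowerbound[of \<Theta> "loop_step fv Q E C p \<Gamma>"] assms
    by (simp add: loop_inv_def env_order_def)
qed

lemma loop_inv_greatest:
  fixes fv :: "'e \<Rightarrow> 'v set"
  assumes "\<Psi> \<in> envs Q"
    and "\<And>\<Theta>. \<Theta> \<in> envs Q \<Longrightarrow> env_le Q (loop_step fv Q E C p \<Gamma> \<Theta>) \<Theta> \<Longrightarrow> env_le Q \<Psi> \<Theta>"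
  shows "env_le Q \<Psi> (loop_inv fv Q E C p \<Gamma>)"
proof -
  interpret L: complete_lattice "env_order Q :: ('v \<Rightarrow> 'a) gorder"
    by (rule complete_lattice_env_order)
  show ?thesis
    using L.weak.LFP_greatest[of \<Psi> "loop_step fv Q E C p \<Gamma>"] assms
    by (simp add: loop_inv_def env_order_def)
qed

lemma post_envs: "p \<in> above_one Q \<Longrightarrow> \<Gamma> \<in> envs Q \<Longrightarrow> post fv Q C p \<Gamma> \<in> envs Q"
proof (induction C arbitrary: p \<Gamma>)
  case (Assign x E)
  then have "qmult Q p (guard fv Q E \<Gamma>) \<in> above_one Q"
    by (simp add: guard_above_one)
  with Assign show ?case
    by (simp add: envs_def)
next
  case (Cond E C1 C2)
  then show ?case
    by (simp add: Let_def if_env_envs guard_above_one)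
next
  case (While E C)
  show ?case
    unfolding post_While by (intro while_env_envs guard_above_one loop_inv_envs)
qed simp_all

lemma loop_step_envs:
  assumes "p \<in> above_one Q" "\<Gamma> \<in> envs Q" "\<Theta> \<in> envs Q"
  shows "loop_step fv Q E C p \<Gamma> \<Theta> \<in> envs Q"
proof -
  have "post fv Q C (qmult Q p (guard fv Q E \<Theta>)) \<Theta> \<in> envs Q"
    using assms by (simp add: post_envs guard_above_one)
  then show ?thesis
    using assms(2) by (auto simp: loop_step_def envs_def)
qed

text \<open>The universal property of the binary join, taken pointwise. With \<Psi> equal to
  \<Theta> it says that the pre-fixed environments are exactly the invariants above
  \<Gamma>.\<close>

lemma loop_step_le_iff:
  assumes "p \<in> above_one Q" "\<Gamma> \<in> envs Q" "\<Theta> \<in> envs Q" "\<Psi> \<in> envs Q"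
  shows "env_le Q (loop_step fv Q E C p \<Gamma> \<Theta>) \<Psi> \<longleftrightarrow>
    env_le Q \<Gamma> \<Psi> \<and> env_le Q (post fv Q C (qmult Q p (guard fv Q E \<Theta>)) \<Theta>) \<Psi>"
proof -
  define \<Phi> where "\<Phi> = post fv Q C (qmult Q p (guard fv Q E \<Theta>)) \<Theta>"
  have \<Phi>: "\<Phi> \<in> envs Q"
    using assms by (simp add: \<Phi>_def post_envs guard_above_one)
  have "\<Gamma> x \<squnion>\<^bsub>Q\<^esub> \<Phi> x \<sqsubseteq>\<^bsub>Q\<^esub> \<Psi> x \<longleftrightarrow> \<Gamma> x \<sqsubseteq>\<^bsub>Q\<^esub> \<Psi> x \<and> \<Phi> x \<sqsubseteq>\<^bsub>Q\<^esub> \<Psi> x" for x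
    using envs_closed[OF assms(2), of x] envs_closed[OF assms(4), of x] envs_closed[OF \<Phi>, of x]
    by (meson lat.join_le lat.join_left lat.join_right lat.join_closed le_trans)
  then show ?thesis
    unfolding loop_step_def \<Phi>_def[symmetric] env_le_def by blast
qed

text \<open>Induction on the command. For a loop, every environment that is pre-fixed for the larger
  data is also pre-fixed for the smaller data, by the induction hypothesis on the body; the meet for
  the smaller data therefore lies below.\<close>

lemma post_mono:
  fixes fv :: "'e \<Rightarrow> 'v::finite set"
  assumes "p \<in> above_one Q" "p' \<in> above_one Q" "\<Gamma> \<in> envs Q" "\<Gamma>' \<in> envs Q"
    and "p \<sqsubseteq>\<^bsub>Q\<^esub> p'" "env_le Q \<Gamma> \<Gamma>'"
  shows "env_le Q (post fv Q C p \<Gamma>) (post fv Q C p' \<Gamma>')"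
  using assms
proof (induction C arbitrary: p p' \<Gamma> \<Gamma>')
  case (Assign x E)
  then have "qmult Q p (guard fv Q E \<Gamma>) \<sqsubseteq>\<^bsub>Q\<^esub> qmult Q p' (guard fv Q E \<Gamma>')"
    by (intro qmult_mono guard_mono guard_closed above_one_closed)
  with Assign show ?case
    by (simp add: env_le_def)
next
  case (Seq C1 C2)
  then show ?case
    by (simp add: post_envs)
next
  case (Cond E C1 C2)
  have "guard fv Q E \<Gamma> \<sqsubseteq>\<^bsub>Q\<^esub> guard fv Q E \<Gamma>'"
    using Cond.prems by (intro guard_mono)
  moreover from this have "qmult Q p (guard fv Q E \<Gamma>) \<sqsubseteq>\<^bsub>Q\<^esub> qmult Q p' (guard fv Q E \<Gamma>')"
    using Cond.prems by (intro qmult_mono guard_closed above_one_closed)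
  ultimately show ?case
    using Cond by (simp add: Let_def if_env_mono post_envs guard_closed guard_above_one)
next
  case (While E C)
  have "env_le Q (loop_inv fv Q E C p \<Gamma>) (loop_inv fv Q E C p' \<Gamma>')"
  proof (rule loop_inv_greatest[OF loop_inv_envs])
    fix \<Theta> assume \<Theta>: "\<Theta> \<in> envs Q" "env_le Q (loop_step fv Q E C p' \<Gamma>' \<Theta>) \<Theta>"
    then have le: "env_le Q \<Gamma>' \<Theta>" "env_le Q (post fv Q C (qmult Q p' (guard fv Q E \<Theta>)) \<Theta>) \<Theta>"
      using While.prems by (simp_all add: loop_step_le_iff)
    have "qmult Q p (guard fv Q E \<Theta>) \<sqsubseteq>\<^bsub>Q\<^esub> qmult Q p' (guard fv Q E \<Theta>)"
      using While.prems \<Theta> by (intro qmult_mono guard_closed above_one_closed le_refl)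
    then have "env_le Q (post fv Q C (qmult Q p (guard fv Q E \<Theta>)) \<Theta>)
      (post fv Q C (qmult Q p' (guard fv Q E \<Theta>)) \<Theta>)"
      using While.prems \<Theta> by (intro While.IH) (simp_all add: guard_above_one)
    then have "env_le Q (post fv Q C (qmult Q p (guard fv Q E \<Theta>)) \<Theta>) \<Theta>"
      by (rule env_le_trans[OF _ le(2)])
        (use While.prems \<Theta> in \<open>simp_all add: post_envs guard_above_one\<close>)
    moreover have "env_le Q \<Gamma> \<Theta>"
      using While.prems \<Theta> le(1) by (meson env_le_trans)
    ultimately have "env_le Q (loop_step fv Q E C p \<Gamma> \<Theta>) \<Theta>"
      using While.prems \<Theta> by (simp add: loop_step_le_iff)
    with \<Theta>(1) show "env_le Q (loop_inv fv Q E C p \<Gamma>) \<Theta>"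
      by (rule loop_inv_lowerbound)
  qed
  then show ?case
    unfolding post_While by (intro while_env_mono guard_mono guard_closed loop_inv_envs)
qed simp_all

lemma loop_step_mono:
  fixes fv :: "'e \<Rightarrow> 'v::finite set"
  assumes "p \<in> above_one Q" "\<Gamma> \<in> envs Q" "\<Theta> \<in> envs Q" "\<Theta>' \<in> envs Q" "env_le Q \<Theta> \<Theta>'"
  shows "env_le Q (loop_step fv Q E C p \<Gamma> \<Theta>) (loop_step fv Q E C p \<Gamma> \<Theta>')"
proof -
  have "qmult Q p (guard fv Q E \<Theta>) \<sqsubseteq>\<^bsub>Q\<^esub> qmult Q p (guard fv Q E \<Theta>')"
    using assms by (intro qmult_mono_right guard_mono guard_closed above_one_closed)
  then have le: "env_le Q (post fv Q C (qmult Q p (guard fv Q E \<Theta>)) \<Theta>)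
      (post fv Q C (qmult Q p (guard fv Q E \<Theta>')) \<Theta>')"
    using assms by (intro post_mono) (simp_all add: guard_above_one)
  \<comment> \<open>The loop step is placed on the right as its own bound: reflexivity then yields
    that it lies above both of its joinands.\<close>
  have "env_le Q \<Gamma> (loop_step fv Q E C p \<Gamma> \<Theta>')" "env_le Q (post fv Q C (qmult Q p (guard fv Q E \<Theta>')) \<Theta>') (loop_step fv Q E C p \<Gamma> \<Theta>')"
    using loop_step_le_iff[of p \<Gamma> \<Theta>' "loop_step fv Q E C p \<Gamma> \<Theta>'" fv E C] assms by (simp_all add: loop_step_envs)
  moreover from this(2) have "env_le Q (post fv Q C (qmult Q p (guard fv Q E \<Theta>)) \<Theta>) (loop_step fv Q E C p \<Gamma> \<Theta>')"
    by (rule env_le_trans[OF le])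
      (use assms in \<open>simp_all add: post_envs guard_above_one loop_step_envs\<close>)
  ultimately show ?thesis
    using assms by (simp add: loop_step_le_iff loop_step_envs)
qed

text \<open>Knaster-Tarski in the lattice of environments, now that \<open>post_mono\<close> has
  made the loop step monotone.\<close>

lemma loop_inv_unfold:
  fixes fv :: "'e \<Rightarrow> 'v::finite set"
  assumes "p \<in> above_one Q" "\<Gamma> \<in> envs Q"
  shows "loop_step fv Q E C p \<Gamma> (loop_inv fv Q E C p \<Gamma>) = loop_inv fv Q E C p \<Gamma>"
proof -
  let ?F = "loop_step fv Q E C p \<Gamma>"
  interpret L: complete_lattice "env_order Q :: ('v \<Rightarrow> 'a) gorder"
    by (rule complete_lattice_env_order)
  have "env_le Q (?F \<Theta>) (?F \<Theta>')"
    if "\<Theta> \<in> envs Q" "\<Theta>' \<in> envs Q" "env_le Q \<Theta> \<Theta>'" for \<Theta> \<Theta>'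
    using assms that by (intro loop_step_mono)
  then have "Mono\<^bsub>env_order Q\<^esub> ?F"
    using L.weak_partial_order_axioms by (simp add: isotone_def env_order_def)
  moreover have "?F \<in> carrier (env_order Q) \<rightarrow> carrier (env_order Q)"
    using assms by (simp add: env_order_def loop_step_envs)
  ultimately have "LFP\<^bsub>env_order Q\<^esub> ?F = ?F (LFP\<^bsub>env_order Q\<^esub> ?F)"
    by (rule L.LFP_unfold)
  then show ?thesis
    by (simp add: loop_inv_def)
qed

lemma loop_inv_above:
  fixes fv :: "'e \<Rightarrow> 'v::finite set" and E C
  assumes "p \<in> above_one Q" "\<Gamma> \<in> envs Q"
  defines "\<Theta> \<equiv> loop_inv fv Q E C p \<Gamma>"
  shows "env_le Q \<Gamma> \<Theta>" "env_le Q (post fv Q C (qmult Q p (guard fv Q E \<Theta>)) \<Theta>) \<Theta>"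
proof -
  have "\<Theta> \<in> envs Q"
    unfolding \<Theta>_def by (rule loop_inv_envs)
  moreover from this have "env_le Q (loop_step fv Q E C p \<Gamma> \<Theta>) \<Theta>"
    unfolding \<Theta>_def using assms by (simp add: loop_inv_unfold)
  ultimately show "env_le Q \<Gamma> \<Theta>" "env_le Q (post fv Q C (qmult Q p (guard fv Q E \<Theta>)) \<Theta>) \<Theta>"
    using assms(1,2) by (simp_all add: loop_step_le_iff)
qed


section \<open>Derivability\<close>

lemma derivable_post:
  fixes fv :: "'e \<Rightarrow> 'v::finite set"
  assumes "p \<in> above_one Q" "\<Gamma> \<in> envs Q"
  shows "derivable (F1 fv) Q (Judgement p \<Gamma> C (post fv Q C p \<Gamma>))"
  using assms
proof (induction C arbitrary: p \<Gamma>)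
  case Skip
  then show ?case
    unfolding post.simps by (intro derivable.intros[OF F1.Skip]) simp_all
next
  case (Assign x E)
  have "derivable (F1 fv) Q (Judgement p \<Gamma> (Assign x E) (\<Gamma>(x := p \<otimes>\<^bsub>tmon Q\<^esub> guard fv Q E \<Gamma>)))"
    by (rule derivable.intros, rule F1.Assign)
      (use Assign post_envs[of p \<Gamma> fv "Assign x E"] in simp_all)
  then show ?case
    unfolding post.simps .
next
  case (Seq C1 C2)
  let ?\<Theta> = "post fv Q C1 p \<Gamma>"
  have "derivable (F1 fv) Q (Judgement p \<Gamma> (Seq C1 C2) (post fv Q C2 p ?\<Theta>))"
    by (rule derivable.intros, rule F1.Seq[of p \<Gamma> C1 ?\<Theta>]) (use Seq in \<open>auto simp: post_envs\<close>)
  then show ?case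
    by simp
next
  case (Cond E C1 C2)
  define t where "t = guard fv Q E \<Gamma>"
  have t: "t \<in> above_one Q"
    using Cond.prems by (simp add: t_def guard_above_one)
  have "derivable (F1 fv) Q (Judgement p \<Gamma> (Cond E C1 C2)
      (if_env Q (asgn C1 \<union> asgn C2) t \<Gamma> (post fv Q C1 (qmult Q p t) \<Gamma>) (post fv Q C2 (qmult Q p t) \<Gamma>)))"
    by (rule derivable.intros, rule F1.Cond[OF t_def, simplified])
      (use Cond t in \<open>auto simp: post_envs if_env_envs\<close>)
  then show ?case
    by (simp add: Let_def t_def)
next
  case (While E C)
  define \<Theta> where "\<Theta> = loop_inv fv Q E C p \<Gamma>"
  define t where "t = guard fv Q E \<Theta>"
  have \<Theta>: "\<Theta> \<in> envs Q"
    unfolding \<Theta>_def by (rule loop_inv_envs)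
  have t: "t \<in> above_one Q"
    using \<Theta> by (simp add: t_def guard_above_one)
  have le: "env_le Q \<Gamma> \<Theta>" "env_le Q (post fv Q C (qmult Q p t) \<Theta>) \<Theta>"
    using loop_inv_above[OF While.prems] by (simp_all add: \<Theta>_def t_def)
  have pt: "qmult Q p t \<in> above_one Q"
    using While.prems t by simp
  \<comment> \<open>The rule (While) wants a body judgement with equal pre- and postcondition. The
    induction hypothesis ends in a postcondition below \<Theta>, which (Sub) raises to
    \<Theta>.\<close>
  have inv: "derivable (F1 fv) Q (Judgement (qmult Q p t) \<Theta> C \<Theta>)"
    by (rule derivable.intros, rule F1.Sub[OF le_refl env_le_refl le(2)])
      (use While.IH[OF pt \<Theta>] pt \<Theta> in \<open>simp_all add: above_one_closed\<close>)
  have loop: "derivable (F1 fv) Q (Judgement p \<Theta> (While E C) (while_env Q (asgn C) t \<Theta>))"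
    by (rule derivable.intros, rule F1.While[OF t_def, simplified])
      (use inv While.prems \<Theta> t in \<open>simp_all add: while_env_envs\<close>)
  \<comment> \<open>A second use of (Sub) lowers the precondition from the invariant to
    \<Gamma>.\<close>
  have "derivable (F1 fv) Q (Judgement p \<Gamma> (While E C) (while_env Q (asgn C) t \<Theta>))"
    by (rule derivable.intros, rule F1.Sub[OF le_refl le(1) env_le_refl])
      (use loop While.prems \<Theta> t in \<open>simp_all add: while_env_envs above_one_closed\<close>)
  then show ?case
    by (simp only: post_While t_def \<Theta>_def)
qed

end

section \<open>The transformer gives the least derivable postcondition\<close>

lemma derivable_imp_judgement_in: "derivable R M J \<Longrightarrow> judgement_in M J"
  by (erule derivable.cases) simp

text \<open>Induction on derivations, with one case for each rule of \<open>F1\<close>. Monotonicity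
  of \<open>post\<close> composes the premises of (Seq) and absorbs the weakening in (Sub).\<close>

lemma (in comm_quantale) post_least:
  fixes fv :: "'e \<Rightarrow> 'v::finite set"
  assumes "derivable (F1 fv) Q (Judgement p \<Gamma> C \<Gamma>')"
  shows "env_le Q (post fv Q C p \<Gamma>) \<Gamma>'"
proof -
  have "\<forall>p \<Gamma> C \<Gamma>'. J = Judgement p \<Gamma> C \<Gamma>' \<longrightarrow> env_le Q (post fv Q C p \<Gamma>) \<Gamma>'"
    if "derivable (F1 fv) Q J" for J
    using that
  proof (induction J rule: derivable.induct)
    case (1 P J)
    have IH: "env_le Q (post fv Q C p \<Gamma>) \<Gamma>'" "p \<in> above_one Q" "\<Gamma> \<in> envs Q" "\<Gamma>' \<in> envs Q"
      if "Judgement p \<Gamma> C \<Gamma>' \<in> P" for p \<Gamma> C \<Gamma>'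
      using 1(4)[OF that] derivable_imp_judgement_in[OF 1(3)[OF that]] by simp_all
    from 1(1,2) show ?case
    proof (cases rule: F1.cases)
      case (Skip p \<Gamma>)
      then show ?thesis using 1(2) by simp
    next
      case (Assign p \<Gamma> x E)
      then show ?thesis using 1(2) by simp
    next
      case (Seq p \<Gamma> C1 \<Gamma>'' C2 \<Gamma>')
      have *: "env_le Q (post fv Q C1 p \<Gamma>) \<Gamma>''" "env_le Q (post fv Q C2 p \<Gamma>'') \<Gamma>'"
        and mem: "p \<in> above_one Q" "\<Gamma> \<in> envs Q" "\<Gamma>'' \<in> envs Q" "\<Gamma>' \<in> envs Q"
        using IH[of p \<Gamma> C1 \<Gamma>''] IH[of p \<Gamma>'' C2 \<Gamma>'] Seq by simp_all
      have "env_le Q (post fv Q C2 p (post fv Q C1 p \<Gamma>)) (post fv Q C2 p \<Gamma>'')"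
        using * mem by (intro post_mono post_envs le_refl above_one_closed)
      then have "env_le Q (post fv Q C2 p (post fv Q C1 p \<Gamma>)) \<Gamma>'"
        by (rule env_le_trans[OF _ *(2)]) (use mem in \<open>simp_all add: post_envs\<close>)
      then show ?thesis using Seq by simp
    next
      case (Cond t E \<Gamma> p C1 \<Gamma>1 C2 \<Gamma>2)
      let ?q = "qmult Q p t"
      have IH1: "env_le Q (post fv Q C1 ?q \<Gamma>) \<Gamma>1" "env_le Q (post fv Q C2 ?q \<Gamma>) \<Gamma>2"
        and mem: "?q \<in> above_one Q" "\<Gamma> \<in> envs Q" "\<Gamma>1 \<in> envs Q" "\<Gamma>2 \<in> envs Q"
        using IH[of ?q \<Gamma> C1 \<Gamma>1] IH[of ?q \<Gamma> C2 \<Gamma>2] Cond by simp_all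
      then have "env_le Q (if_env Q (asgn C1 \<union> asgn C2) t \<Gamma> (post fv Q C1 ?q \<Gamma>) (post fv Q C2 ?q \<Gamma>))
          (if_env Q (asgn C1 \<union> asgn C2) t \<Gamma> \<Gamma>1 \<Gamma>2)"
        using \<open>t = _\<close> by (intro if_env_mono post_envs) (simp_all add: guard_closed)
      then show ?thesis using Cond by (simp add: Let_def)
    next
      case (While t E \<Gamma> p C)
      have p: "p \<in> above_one Q"
        using 1(2) While by simp
      have *: "env_le Q (post fv Q C (qmult Q p t) \<Gamma>) \<Gamma>" and \<Gamma>: "\<Gamma> \<in> envs Q"
        using IH[of "qmult Q p t" \<Gamma> C \<Gamma>] While by simp_all
      \<comment> \<open>The premise of (While) makes \<Gamma> pre-fixed for the loop step started at
        \<Gamma> itself, so the least invariant lies below \<Gamma>.\<close>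
      then have "env_le Q (loop_inv fv Q E C p \<Gamma>) \<Gamma>"
        using p \<open>t = _\<close> by (intro loop_inv_lowerbound) (simp_all add: loop_step_le_iff)
      then have "env_le Q (post fv Q (While E C) p \<Gamma>) (while_env Q (asgn C) t \<Gamma>)"
        unfolding post_While \<open>t = _\<close> using \<Gamma>
        by (intro while_env_mono guard_mono guard_closed loop_inv_envs)
      then show ?thesis using While by (simp del: post.simps)
    next
      case (Sub p' p \<Gamma>' \<Gamma> \<Gamma>1 \<Gamma>2 C)
      have *: "env_le Q (post fv Q C p \<Gamma>) \<Gamma>1" and mem: "p \<in> above_one Q" "\<Gamma> \<in> envs Q" "\<Gamma>1 \<in> envs Q"
        using IH[of p \<Gamma> C \<Gamma>1] Sub by simp_all
      have mem': "p' \<in> above_one Q" "\<Gamma>' \<in> envs Q" "\<Gamma>2 \<in> envs Q"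
        using 1(2) Sub by simp_all
      have "env_le Q (post fv Q C p' \<Gamma>') (post fv Q C p \<Gamma>)"
        using mem mem' Sub by (intro post_mono)
      then have "env_le Q (post fv Q C p' \<Gamma>') \<Gamma>1"
        by (rule env_le_trans[OF _ *]) (use mem mem' in \<open>simp_all add: post_envs\<close>)
      then have "env_le Q (post fv Q C p' \<Gamma>') \<Gamma>2"
        by (rule env_le_trans) (use Sub mem mem' in \<open>simp_all add: post_envs\<close>)
      then show ?thesis using Sub by simp
    qed
  qed
  with assms show ?thesis
    by blast
qed

lemma (in comm_quantale) joint_bounds_closed: "joint_bounds R Q C \<sigma> W \<subseteq> carrier Q"
  by (auto simp: joint_bounds_def envs_closed dest!: derivable_imp_judgement_in)

text \<open>A least member of a set is its meet. Membership comes from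
  \<open>derivable_post\<close>; minimality comes from \<open>post_least\<close>, carried through
  the tensor by \<open>finprod_mono\<close>.\<close>

lemma (in comm_quantale) Inf_joint_bounds_F1:
  fixes fv :: "'e \<Rightarrow> 'v::finite set"
  assumes \<sigma>: "\<sigma> \<in> envs Q"
  shows "\<Sqinter>\<^bsub>Q\<^esub>(joint_bounds (F1 fv) Q C \<sigma> W) = (\<Otimes>\<^bsub>tmon Q\<^esub>w\<in>W. post fv Q C (qone Q) \<sigma> w)"
proof -
  let ?B = "joint_bounds (F1 fv) Q C \<sigma> W" and ?m = "\<Otimes>\<^bsub>tmon Q\<^esub>w\<in>W. post fv Q C (qone Q) \<sigma> w"
  have post: "post fv Q C (qone Q) \<sigma> \<in> envs Q"
    using \<sigma> by (simp add: post_envs)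
  have envs: "\<Gamma>' \<in> envs Q" if "derivable (F1 fv) Q (Judgement (qone Q) \<sigma> C \<Gamma>')" for \<Gamma>'
    using derivable_imp_judgement_in[OF that] by simp
  have B: "?B \<subseteq> carrier Q"
    by (rule joint_bounds_closed)
  have m: "?m \<in> ?B"
    unfolding joint_bounds_def using derivable_post[OF above_one_qone \<sigma>] by auto
  have "?m \<sqsubseteq>\<^bsub>Q\<^esub> b" if b_in: "b \<in> ?B" for b
  proof -
    obtain \<Gamma>' where b: "b = (\<Otimes>\<^bsub>tmon Q\<^esub>w\<in>W. \<Gamma>' w)"
      and der: "derivable (F1 fv) Q (Judgement (qone Q) \<sigma> C \<Gamma>')"
      using b_in by (auto simp: joint_bounds_def)
    show ?thesis
      unfolding b using post_least[OF der] envs[OF der] post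
      by (intro finprod_mono) (simp_all add: envs_closed env_le_def)
  qed
  then have "?m \<sqsubseteq>\<^bsub>Q\<^esub> \<Sqinter>\<^bsub>Q\<^esub>?B"
    using B m by (intro lat.weak.inf_greatest) auto
  moreover have "\<Sqinter>\<^bsub>Q\<^esub>?B \<sqsubseteq>\<^bsub>Q\<^esub> ?m"
    using B m by (rule lat.weak.inf_lower)
  ultimately show ?thesis
    using B m by (intro lat.le_antisym) auto
qed


section \<open>Lax maps\<close>

text \<open>Lax unitality puts \<open>f (qone A)\<close> above the unit, and monotonicity puts
  \<open>f a\<close> above that. Hence a lax map on the whole carrier restricts to the domain that
  renaming stability speaks of.\<close>

lemma lax_map_above_one:
  assumes "comm_quantale B" "comm_quantale A" "lax_map A (carrier A) B (carrier B) f"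
    and "a \<in> above_one A"
  shows "f a \<in> above_one B"
proof -
  interpret A: comm_quantale A by fact
  interpret B: comm_quantale B by fact
  have "f (qone A) \<in> above_one B"
    using assms(3) by (simp add: lax_map_def Pi_iff above_one_def)
  moreover have "f (qone A) \<sqsubseteq>\<^bsub>B\<^esub> f a" "f a \<in> carrier B"
    using assms(3,4) by (simp_all add: lax_map_def Pi_iff above_one_def)
  ultimately show ?thesis
    by (meson B.above_one_up)
qed

text \<open>Induction on the finite index set: lax unitality settles the empty tensor, lax
  monoidality each further factor.\<close>

lemma lax_map_finprod:
  assumes "comm_quantale B" "comm_quantale A" "lax_map A (carrier A) B (carrier B) f"
    and "finite S" "g \<in> S \<rightarrow> carrier A"
  shows "finprod (tmon B) (\<lambda>x. f (g x)) S \<sqsubseteq>\<^bsub>B\<^esub> f (finprod (tmon A) g S)"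
proof -
  interpret A: comm_quantale A by fact
  interpret B: comm_quantale B by fact
  have f: "f a \<in> carrier B" if "a \<in> carrier A" for a
    using assms(3) that by (auto simp: lax_map_def)
  have f_mult: "qmult B (f a) (f b) \<sqsubseteq>\<^bsub>B\<^esub> f (qmult A a b)" if "a \<in> carrier A" "b \<in> carrier A" for a b
    using assms(3) that by (simp add: lax_map_def)
  from assms(4,5) show ?thesis
  proof (induction S rule: finite_induct)
    case empty
    then show ?case
      using assms(3) by (simp add: lax_map_def)
  next
    case (insert x S)
    then have g: "g x \<in> carrier A" "g \<in> S \<rightarrow> carrier A"
      by auto
    then have fg: "(\<lambda>x. f (g x)) \<in> S \<rightarrow> carrier B"
      by (simp add: Pi_iff f)
    have "qmult B (f (g x)) (finprod (tmon B) (\<lambda>x. f (g x)) S) \<sqsubseteq>\<^bsub>B\<^esub>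
        qmult B (f (g x)) (f (finprod (tmon A) g S))"
      using insert.IH[OF g(2)] g fg by (intro B.qmult_mono_right) (simp_all add: f)
    also have "\<dots> \<sqsubseteq>\<^bsub>B\<^esub> f (qmult A (g x) (finprod (tmon A) g S))"
      using g by (intro f_mult) simp_all
    finally have "qmult B (f (g x)) (finprod (tmon B) (\<lambda>x. f (g x)) S) \<sqsubseteq>\<^bsub>B\<^esub>
        f (qmult A (g x) (finprod (tmon A) g S))"
      using g fg by (simp add: f)
    then show ?case
      using insert.hyps g fg by (simp add: f)
  qed
qed


section \<open>Quantale homomorphisms\<close>

text \<open>The axioms preserve the unit, tensors and joins, from which \<open>post\<close> is built
  apart from its least fixed point. Preservation of the latter is derived.\<close>

locale quantale_hom = A: comm_quantale A + B: comm_quantale B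
  for A :: "'a quantale" and B :: "'b quantale" +
  fixes f :: "'a \<Rightarrow> 'b"
  assumes hom_closed: "a \<in> carrier A \<Longrightarrow> f a \<in> carrier B"
    and hom_one: "f (qone A) = qone B"
    and hom_mult: "a \<in> carrier A \<Longrightarrow> b \<in> carrier A \<Longrightarrow> f (qmult A a b) = qmult B (f a) (f b)"
    and hom_Sup: "S \<subseteq> carrier A \<Longrightarrow> f (\<Squnion>\<^bsub>A\<^esub>S) = \<Squnion>\<^bsub>B\<^esub>(f ` S)"
begin

lemma hom_join: "a \<in> carrier A \<Longrightarrow> b \<in> carrier A \<Longrightarrow> f (a \<squnion>\<^bsub>A\<^esub> b) = f a \<squnion>\<^bsub>B\<^esub> f b"
  by (simp add: join_def hom_Sup)

text \<open>The order is recovered from joins: for a below b, \<open>f b\<close> is the join of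
  \<open>f a\<close> and \<open>f b\<close>.\<close>

lemma hom_mono:
  assumes "a \<in> carrier A" "b \<in> carrier A" "a \<sqsubseteq>\<^bsub>A\<^esub> b"
  shows "f a \<sqsubseteq>\<^bsub>B\<^esub> f b"
proof -
  have "f b = \<Squnion>\<^bsub>B\<^esub>{f a, f b}"
    using hom_Sup[of "{a, b}"] assms by (simp add: A.Sup_pair_absorb)
  then show ?thesis
    using assms by (metis B.Sup_upper insertI1 empty_subsetI insert_subset hom_closed)
qed

lemma hom_above_one: "a \<in> above_one A \<Longrightarrow> f a \<in> above_one B"
  using hom_mono[of "qone A" a] by (simp add: above_one_def hom_closed hom_one)

lemma hom_envs: "\<Gamma> \<in> envs A \<Longrightarrow> f \<circ> \<Gamma> \<in> envs B"
  by (simp add: envs_def hom_above_one)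

lemma hom_pow: "a \<in> carrier A \<Longrightarrow> f (a [^]\<^bsub>tmon A\<^esub> (n::nat)) = f a [^]\<^bsub>tmon B\<^esub> n"
  by (induction n) (simp_all add: hom_one hom_mult)

lemma hom_qstar:
  assumes "a \<in> carrier A"
  shows "f (qstar A a) = qstar B (f a)"
proof -
  have "range (\<lambda>n::nat. a [^]\<^bsub>tmon A\<^esub> n) \<subseteq> carrier A"
    using assms by auto
  then show ?thesis
    using assms by (simp add: qstar_def hom_Sup image_image hom_pow)
qed

lemma hom_finprod:
  assumes "g \<in> S \<rightarrow> carrier A"
  shows "f (finprod (tmon A) g S) = finprod (tmon B) (f \<circ> g) S"
  using assms
  by (induction S rule: infinite_finite_induct) (auto simp: Pi_iff hom_one hom_mult hom_closed)

lemma hom_guard: "\<Gamma> \<in> envs A \<Longrightarrow> f (guard fv A E \<Gamma>) = guard fv B E (f \<circ> \<Gamma>)"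
  unfolding guard_def by (simp add: hom_finprod A.envs_closed o_def)

lemma hom_if_env:
  assumes "t \<in> carrier A" "\<Gamma>1 \<in> envs A" "\<Gamma>2 \<in> envs A"
  shows "f \<circ> if_env A X t \<Gamma> \<Gamma>1 \<Gamma>2 = if_env B X (f t) (f \<circ> \<Gamma>) (f \<circ> \<Gamma>1) (f \<circ> \<Gamma>2)"
  using assms by (auto simp: if_env_def fun_eq_iff hom_mult hom_join A.envs_closed)

lemma hom_while_env:
  assumes "t \<in> carrier A" "\<Gamma> \<in> envs A"
  shows "f \<circ> while_env A X t \<Gamma> = while_env B X (f t) (f \<circ> \<Gamma>)"
  using assms by (auto simp: while_env_def fun_eq_iff hom_mult hom_qstar A.envs_closed)

section \<open>The right adjoint and preservation of loop invariants\<close>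

definition adj :: "'b \<Rightarrow> 'a"
  where "adj b = \<Squnion>\<^bsub>A\<^esub>{a \<in> carrier A. f a \<sqsubseteq>\<^bsub>B\<^esub> b}"

lemma adj_closed: "adj b \<in> carrier A"
  unfolding adj_def by (rule A.Sup_closed) auto

lemma adj_upper: "a \<in> carrier A \<Longrightarrow> f a \<sqsubseteq>\<^bsub>B\<^esub> b \<Longrightarrow> a \<sqsubseteq>\<^bsub>A\<^esub> adj b"
  unfolding adj_def by (rule A.Sup_upper) auto

text \<open>Preservation of joins enters here: \<open>f\<close> turns the join defining
  \<open>adj b\<close> into a join of elements below b.\<close>

lemma hom_adj_le: "b \<in> carrier B \<Longrightarrow> f (adj b) \<sqsubseteq>\<^bsub>B\<^esub> b"
  unfolding adj_def by (subst hom_Sup) (auto intro!: B.Sup_least hom_closed)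

lemma adj_galois:
  assumes "a \<in> carrier A" "b \<in> carrier B"
  shows "a \<sqsubseteq>\<^bsub>A\<^esub> adj b \<longleftrightarrow> f a \<sqsubseteq>\<^bsub>B\<^esub> b"
  using assms by (meson adj_upper hom_adj_le hom_mono adj_closed hom_closed B.le_trans)

text \<open>By the Galois connection \<open>adj b\<close> is above the unit of \<open>A\<close> as
  soon as \<open>f (qone A)\<close>, which is the unit of \<open>B\<close>, lies below b.\<close>

lemma adj_envs: "\<Theta> \<in> envs B \<Longrightarrow> adj \<circ> \<Theta> \<in> envs A"
  by (simp add: envs_def above_one_def adj_closed adj_galois hom_one)

lemma env_le_adj_iff:
  assumes "\<Gamma> \<in> envs A" "\<Theta> \<in> envs B"
  shows "env_le A \<Gamma> (adj \<circ> \<Theta>) \<longleftrightarrow> env_le B (f \<circ> \<Gamma>) \<Theta>"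
  using assms by (simp add: env_le_def adj_galois A.envs_closed B.envs_closed)

text \<open>A quantale homomorphism has a right adjoint, which carries pre-fixed points of the loop
  step in \<open>B\<close> back to \<open>A\<close>; this is why it preserves the least fixed points.\<close>

lemma hom_loop_inv:
  fixes fv :: "'e \<Rightarrow> 'v::finite set"
  assumes post: "\<And>p \<Gamma>. p \<in> above_one A \<Longrightarrow> \<Gamma> \<in> envs A \<Longrightarrow>
      f \<circ> post fv A C p \<Gamma> = post fv B C (f p) (f \<circ> \<Gamma>)"
    and p: "p \<in> above_one A" and \<Gamma>: "\<Gamma> \<in> envs A"
  shows "f \<circ> loop_inv fv A E C p \<Gamma> = loop_inv fv B E C (f p) (f \<circ> \<Gamma>)"
proof (rule B.env_le_antisym)
  have step: "f \<circ> loop_step fv A E C p \<Gamma> \<Theta> = loop_step fv B E C (f p) (f \<circ> \<Gamma>) (f \<circ> \<Theta>)"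
    if "\<Theta> \<in> envs A" for \<Theta>
  proof -
    define \<Phi> where "\<Phi> = post fv A C (qmult A p (guard fv A E \<Theta>)) \<Theta>"
    have "\<Phi> \<in> envs A"
      using that p by (simp add: \<Phi>_def A.post_envs A.guard_above_one)
    moreover have "f \<circ> \<Phi> = post fv B C (qmult B (f p) (guard fv B E (f \<circ> \<Theta>))) (f \<circ> \<Theta>)"
      using that p
      by (simp add: \<Phi>_def post A.guard_above_one hom_mult A.above_one_closed A.guard_closed hom_guard)
    ultimately show ?thesis
      using \<Gamma> by (auto simp: loop_step_def \<Phi>_def[symmetric] fun_eq_iff hom_join A.envs_closed)
  qed
  let ?\<Theta> = "loop_inv fv B E C (f p) (f \<circ> \<Gamma>)" and ?\<Psi> = "loop_inv fv A E C p \<Gamma>"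
  note mem = hom_above_one[OF p] hom_envs[OF \<Gamma>]
  have \<Theta>: "?\<Theta> \<in> envs B" and \<Psi>: "?\<Psi> \<in> envs A"
    by (rule B.loop_inv_envs A.loop_inv_envs)+
  then show "f \<circ> ?\<Psi> \<in> envs B" "?\<Theta> \<in> envs B"
    by (simp_all add: hom_envs)
  \<comment> \<open>The image of the invariant in \<open>A\<close> is a fixed point in
    \<open>B\<close>, which gives one of the two inequalities.\<close>
  have "loop_step fv B E C (f p) (f \<circ> \<Gamma>) (f \<circ> ?\<Psi>) = f \<circ> ?\<Psi>"
    using \<Psi> p \<Gamma> by (simp add: A.loop_inv_unfold flip: step)
  then show "env_le B ?\<Theta> (f \<circ> ?\<Psi>)"
    using \<Psi> by (intro B.loop_inv_lowerbound) (simp_all add: hom_envs)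
  \<comment> \<open>For the other inequality, \<open>f\<close> after the step at \<open>?G\<close>
    is the step at \<open>f \<circ> ?G\<close>, which lies below the step at
    \<open>?\<Theta>\<close>, that is, below \<open>?\<Theta>\<close>. Transposed along the
    adjunction, this makes \<open>?G\<close> pre-fixed in \<open>A\<close>.\<close>
  let ?G = "adj \<circ> ?\<Theta>"
  have G: "?G \<in> envs A"
    using \<Theta> by (rule adj_envs)
  have "env_le B (f \<circ> ?G) ?\<Theta>"
    using \<Theta> G by (simp flip: env_le_adj_iff)
  then have "env_le B (loop_step fv B E C (f p) (f \<circ> \<Gamma>) (f \<circ> ?G)) (loop_step fv B E C (f p) (f \<circ> \<Gamma>) ?\<Theta>)"
    using mem \<Theta> G by (intro B.loop_step_mono) (simp_all add: hom_envs)
  then have "env_le B (f \<circ> loop_step fv A E C p \<Gamma> ?G) ?\<Theta>"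
    using mem G by (simp add: step B.loop_inv_unfold)
  then have "env_le A (loop_step fv A E C p \<Gamma> ?G) ?G"
    using p \<Gamma> G \<Theta> by (simp add: env_le_adj_iff A.loop_step_envs)
  then have "env_le A ?\<Psi> ?G"
    using G by (intro A.loop_inv_lowerbound)
  then show "env_le B (f \<circ> ?\<Psi>) ?\<Theta>"
    using \<Psi> \<Theta> by (simp add: env_le_adj_iff)
qed

text \<open>Induction on the command, for all \<open>p\<close> and \<Gamma> at once. The loop case
  hands its induction hypothesis on the body to \<open>hom_loop_inv\<close>.\<close>

lemma hom_post:
  fixes fv :: "'e \<Rightarrow> 'v::finite set"
  assumes "p \<in> above_one A" "\<Gamma> \<in> envs A"
  shows "f \<circ> post fv A C p \<Gamma> = post fv B C (f p) (f \<circ> \<Gamma>)"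
  using assms
proof (induction C arbitrary: p \<Gamma>)
  case (Assign x E)
  then show ?case
    by (auto simp: fun_eq_iff hom_mult A.above_one_closed A.guard_closed hom_guard o_def)
next
  case (Seq C1 C2)
  then show ?case
    by (simp add: A.post_envs)
next
  case (Cond E C1 C2)
  then show ?case
    by (simp add: Let_def hom_if_env hom_guard hom_mult A.post_envs A.guard_above_one A.guard_closed
        A.above_one_closed del: o_apply)
next
  case (While E C)
  have "f \<circ> loop_inv fv A E C p \<Gamma> = loop_inv fv B E C (f p) (f \<circ> \<Gamma>)"
    using While.IH While.prems by (rule hom_loop_inv)
  then show ?case
    unfolding post_While
    by (simp add: hom_while_env hom_guard A.loop_inv_envs A.guard_closed)
qed simp

end


section \<open>The multiset object\<close>

context comm_quantale
begin

text \<open>A multiset read as a monomial with exponents \<open>m v\<close>, evaluated at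
  \<sigma>.\<close>

definition monomial :: "('v \<Rightarrow> 'a) \<Rightarrow> ('v \<Rightarrow> nat) \<Rightarrow> 'a"
  where "monomial \<sigma> m = (\<Otimes>\<^bsub>tmon Q\<^esub>v\<in>UNIV. \<sigma> v [^]\<^bsub>tmon Q\<^esub> m v)"

lemma alphaN_monomial: "alphaN Q \<sigma> D = \<Squnion>\<^bsub>Q\<^esub>(monomial \<sigma> ` D)"
  by (simp add: alphaN_def monomial_def)

lemma monomial_closed: "\<sigma> \<in> envs Q \<Longrightarrow> monomial \<sigma> m \<in> carrier Q"
  unfolding monomial_def by (simp add: envs_closed)

lemma monomial_zero: "monomial \<sigma> (\<lambda>_. 0) = qone Q"
  unfolding monomial_def by (rule mon.finprod_one_eqI[simplified]) simp

lemma monomial_add: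
  assumes "\<sigma> \<in> envs Q"
  shows "monomial \<sigma> (\<lambda>v. m v + n v) = qmult Q (monomial \<sigma> m) (monomial \<sigma> n)"
proof -
  have "monomial \<sigma> (\<lambda>v. m v + n v) =
      (\<Otimes>\<^bsub>tmon Q\<^esub>v\<in>UNIV. \<sigma> v [^]\<^bsub>tmon Q\<^esub> m v \<otimes>\<^bsub>tmon Q\<^esub> \<sigma> v [^]\<^bsub>tmon Q\<^esub> n v)"
    unfolding monomial_def using assms mon.nat_pow_mult
    by (intro mon.finprod_cong') (simp_all add: envs_closed)
  also have "\<dots> = qmult Q (monomial \<sigma> m) (monomial \<sigma> n)"
    unfolding monomial_def using assms
    by (subst mon.finprod_multf) (simp_all add: envs_closed)
  finally show ?thesis .
qed

text \<open>The values of \<sigma> lie above the unit, so larger exponents give larger powers. This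
  is why closing a set of multisets downwards does not change its value.\<close>

lemma monomial_mono:
  fixes \<sigma> :: "'v::finite \<Rightarrow> 'a"
  assumes "\<sigma> \<in> envs Q" "\<And>v. m v \<le> n v"
  shows "monomial \<sigma> m \<sqsubseteq>\<^bsub>Q\<^esub> monomial \<sigma> n"
  unfolding monomial_def using assms
  by (intro finprod_mono) (simp_all add: envs_closed envs_above_one qpow_mono_exp)

lemma monomial_unit:
  fixes \<sigma> :: "'v::finite \<Rightarrow> 'a"
  assumes "\<sigma> \<in> envs Q"
  shows "monomial \<sigma> ((\<lambda>_. 0)(v := 1)) = \<sigma> v"
proof -
  have "monomial \<sigma> ((\<lambda>_. 0)(v := 1)) = (\<Otimes>\<^bsub>tmon Q\<^esub>w\<in>UNIV. if v = w then \<sigma> w else \<one>\<^bsub>tmon Q\<^esub>)"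
    unfolding monomial_def using assms by (intro mon.finprod_cong') (auto simp: envs_closed)
  also have "\<dots> = \<sigma> v"
    using assms by (intro mon.finprod_singleton) (simp_all add: envs_closed)
  finally show ?thesis .
qed

text \<open>The generator of a principal downset dominates all its other monomials, so the join is
  attained there. The unit of \<open>UNat\<close> and the generators \<open>gen v\<close> are both
  of this kind.\<close>

lemma alphaN_down:
  fixes \<sigma> :: "'v::finite \<Rightarrow> 'a"
  assumes "\<sigma> \<in> envs Q"
  shows "alphaN Q \<sigma> (down {m}) = monomial \<sigma> m"
  unfolding alphaN_monomial
proof (rule lat.le_antisym)
  have sub: "monomial \<sigma> ` down {m} \<subseteq> carrier Q"
    using assms by (auto simp: monomial_closed)
  show "\<Squnion>\<^bsub>Q\<^esub>(monomial \<sigma> ` down {m}) \<sqsubseteq>\<^bsub>Q\<^esub> monomial \<sigma> m"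
    using sub assms
    by (intro Sup_least) (auto simp: monomial_closed down_def le_fun_def intro: monomial_mono)
  show "monomial \<sigma> m \<sqsubseteq>\<^bsub>Q\<^esub> \<Squnion>\<^bsub>Q\<^esub>(monomial \<sigma> ` down {m})"
    using sub by (intro Sup_upper imageI) (auto simp: down_def)
  show "\<Squnion>\<^bsub>Q\<^esub>(monomial \<sigma> ` down {m}) \<in> carrier Q"
    using sub by simp
  show "monomial \<sigma> m \<in> carrier Q"
    using assms by (rule monomial_closed)
qed

text \<open>A join over a union is the join of the joins over its members. Since joins in
  \<open>UNat\<close> are unions, this is preservation of joins.\<close>

lemma alphaN_Union:
  assumes \<sigma>: "\<sigma> \<in> envs Q"
  shows "alphaN Q \<sigma> (\<Union>S) = \<Squnion>\<^bsub>Q\<^esub>(alphaN Q \<sigma> ` S)"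
proof (rule lat.le_antisym)
  have sub: "monomial \<sigma> ` D \<subseteq> carrier Q" for D
    using \<sigma> by (auto simp: monomial_closed)
  then have cl: "alphaN Q \<sigma> D \<in> carrier Q" for D
    by (simp add: alphaN_monomial)
  then have subS: "alphaN Q \<sigma> ` S \<subseteq> carrier Q"
    by auto
  show "alphaN Q \<sigma> (\<Union>S) \<sqsubseteq>\<^bsub>Q\<^esub> \<Squnion>\<^bsub>Q\<^esub>(alphaN Q \<sigma> ` S)"
    unfolding alphaN_monomial[of _ "\<Union>S"]
  proof (rule Sup_least[OF sub])
    fix x assume "x \<in> monomial \<sigma> ` \<Union>S"
    then obtain D where D: "D \<in> S" "x \<in> monomial \<sigma> ` D"
      by auto
    have "x \<sqsubseteq>\<^bsub>Q\<^esub> alphaN Q \<sigma> D"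
      unfolding alphaN_monomial using D(2) sub by (rule Sup_upper)
    moreover have "alphaN Q \<sigma> D \<sqsubseteq>\<^bsub>Q\<^esub> \<Squnion>\<^bsub>Q\<^esub>(alphaN Q \<sigma> ` S)"
      using D(1) subS by (intro Sup_upper) auto
    ultimately show "x \<sqsubseteq>\<^bsub>Q\<^esub> \<Squnion>\<^bsub>Q\<^esub>(alphaN Q \<sigma> ` S)"
      using D(2) sub subS cl by (meson le_trans subsetD Sup_closed)
  qed (simp add: subS)
  show "\<Squnion>\<^bsub>Q\<^esub>(alphaN Q \<sigma> ` S) \<sqsubseteq>\<^bsub>Q\<^esub> alphaN Q \<sigma> (\<Union>S)"
  proof (rule Sup_least[OF subS cl])
    fix y assume "y \<in> alphaN Q \<sigma> ` S"
    then show "y \<sqsubseteq>\<^bsub>Q\<^esub> alphaN Q \<sigma> (\<Union>S)"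
      unfolding alphaN_monomial by (auto intro!: Sup_mono sub) (use \<sigma> in \<open>blast intro: le_refl monomial_closed\<close>)
  qed
qed (use \<sigma> in \<open>auto simp: alphaN_monomial image_subset_iff monomial_closed intro!: Sup_closed\<close>)

text \<open>The tensor of \<open>UNat\<close> consists of the multisets below some sum m + n. Sums
  evaluate to products by \<open>monomial_add\<close>, and smaller multisets contribute nothing new
  by \<open>monomial_mono\<close>. Conversely, \<open>Sup_qmult_Sup_le\<close> multiplies out the
  two joins.\<close>

lemma alphaN_qmult:
  fixes \<sigma> :: "'v::finite \<Rightarrow> 'a"
  assumes \<sigma>: "\<sigma> \<in> envs Q"
  shows "alphaN Q \<sigma> (qmult UNat D D') = qmult Q (alphaN Q \<sigma> D) (alphaN Q \<sigma> D')"
  unfolding alphaN_monomial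
proof (rule lat.le_antisym)
  have sub: "monomial \<sigma> ` X \<subseteq> carrier Q" for X
    using \<sigma> by (auto simp: monomial_closed)
  let ?S = "\<lambda>X. \<Squnion>\<^bsub>Q\<^esub>(monomial \<sigma> ` X)"
  show cl: "?S (qmult UNat D D') \<in> carrier Q" "qmult Q (?S D) (?S D') \<in> carrier Q"
    using sub by simp_all
  show "?S (qmult UNat D D') \<sqsubseteq>\<^bsub>Q\<^esub> qmult Q (?S D) (?S D')"
  proof (rule Sup_least[OF sub cl(2)])
    fix x assume "x \<in> monomial \<sigma> ` qmult UNat D D'"
    then obtain k m n where x: "x = monomial \<sigma> k" and mn: "m \<in> D" "n \<in> D'"
      and k: "\<And>v. k v \<le> m v + n v"
      by (auto simp: qmult_UNat_iff)
    have "x \<sqsubseteq>\<^bsub>Q\<^esub> qmult Q (monomial \<sigma> m) (monomial \<sigma> n)"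
      unfolding x monomial_add[OF \<sigma>, symmetric] using \<sigma> k by (rule monomial_mono)
    moreover have "qmult Q (monomial \<sigma> m) (monomial \<sigma> n) \<sqsubseteq>\<^bsub>Q\<^esub> qmult Q (?S D) (?S D')"
      using mn \<sigma> sub by (intro qmult_mono Sup_upper) (simp_all add: monomial_closed)
    ultimately show "x \<sqsubseteq>\<^bsub>Q\<^esub> qmult Q (?S D) (?S D')"
      by (rule le_trans) (use \<sigma> sub in \<open>simp_all add: x monomial_closed\<close>)
  qed
  show "qmult Q (?S D) (?S D') \<sqsubseteq>\<^bsub>Q\<^esub> ?S (qmult UNat D D')"
  proof (rule Sup_qmult_Sup_le[OF sub sub cl(1)])
    fix a b assume "a \<in> monomial \<sigma> ` D" "b \<in> monomial \<sigma> ` D'"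
    then obtain m n where mn: "m \<in> D" "n \<in> D'" "a = monomial \<sigma> m" "b = monomial \<sigma> n"
      by auto
    then have "(\<lambda>v. m v + n v) \<in> qmult UNat D D'"
      by (auto simp: qmult_UNat_iff)
    then show "qmult Q a b \<sqsubseteq>\<^bsub>Q\<^esub> ?S (qmult UNat D D')"
      unfolding mn monomial_add[OF \<sigma>, symmetric] using sub by (intro Sup_upper imageI)
  qed
qed

lemma quantale_hom_alphaN:
  fixes \<sigma> :: "'v::finite \<Rightarrow> 'a"
  assumes \<sigma>: "\<sigma> \<in> envs Q"
  shows "quantale_hom UNat Q (alphaN Q \<sigma>)"
proof (intro quantale_hom.intro quantale_hom_axioms.intro)
  show "comm_quantale (UNat :: ('v \<Rightarrow> nat) set quantale)" "comm_quantale Q"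
    by (rule comm_quantale_UNat comm_quantale_axioms)+
  show "alphaN Q \<sigma> D \<in> carrier Q" for D
    unfolding alphaN_monomial by (rule Sup_closed) (auto simp: monomial_closed[OF \<sigma>])
  have "qone UNat = down {\<lambda>v::'v. 0}"
    by (simp add: UNat_def)
  then show "alphaN Q \<sigma> (qone UNat) = qone Q"
    using alphaN_down[OF \<sigma>] by (simp add: monomial_zero)
  show "alphaN Q \<sigma> (qmult UNat D D') = qmult Q (alphaN Q \<sigma> D) (alphaN Q \<sigma> D')" for D D'
    using \<sigma> by (rule alphaN_qmult)
  show "alphaN Q \<sigma> (\<Squnion>\<^bsub>UNat\<^esub>S) = \<Squnion>\<^bsub>Q\<^esub>(alphaN Q \<sigma> ` S)" if "S \<subseteq> carrier UNat" for S
    using alphaN_Union[OF \<sigma>] Sup_UNat(2)[OF that] by simp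
qed

end

lemma gen_envs: "gen \<in> envs UNat"
  by (auto simp: envs_def above_one_def gen_def qone_UNat UNat_def down_def intro: order_trans)
    (simp add: le_fun_def)


section \<open>The bound for type objects and its exact value for \<open>F1\<close>\<close>

theorem theorem7:
  fixes fv :: "'e \<Rightarrow> 'v::finite set"
    and R :: "('v, 'e, 'u) rule_set"
    and M V :: "'u quantale"
    and \<iota> \<Delta> \<sigma> :: "'v \<Rightarrow> 'u"
    and h :: "('v \<Rightarrow> 'u) \<Rightarrow> 'u \<Rightarrow> 'u"
    and C :: "('v, 'e) com"
    and W :: "'v set"
  assumes "comm_quantale M"
    and "\<sigma> \<in> envs M"
  shows "(renaming_stable R \<and> admits_sub R \<and> type_object M V \<iota> h \<and>
      derivable R V (Judgement \<one>\<^bsub>tmon V\<^esub> \<iota> C \<Delta>) \<longrightarrow>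
        \<Sqinter>\<^bsub>M\<^esub>(joint_bounds R M C \<sigma> W) \<sqsubseteq>\<^bsub>M\<^esub> h \<sigma> (\<Otimes>\<^bsub>tmon V\<^esub>w\<in>W. \<Delta> w)) \<and>
    (R = F1 fv \<longrightarrow>
      \<Sqinter>\<^bsub>M\<^esub>(joint_bounds R M C \<sigma> W) = alphaN M \<sigma> (JN fv C W))"
proof -
  interpret M: comm_quantale M
    by (rule assms(1))
  note \<sigma> = assms(2)
  show ?thesis
  proof (intro conjI impI)
    assume asm: "renaming_stable R \<and> admits_sub R \<and> type_object M V \<iota> h \<and>
      derivable R V (Judgement \<one>\<^bsub>tmon V\<^esub> \<iota> C \<Delta>)"
    then interpret V: comm_quantale V
      by (simp add: type_object_def)
    let ?f = "h \<sigma>"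
    have lax: "lax_map V (carrier V) M (carrier M) ?f" and above: "\<sigma> v \<sqsubseteq>\<^bsub>M\<^esub> ?f (\<iota> v)" for v
      using asm \<sigma> by (simp_all add: type_object_def)
    have \<Delta>: "\<Delta> \<in> envs V" and \<iota>: "\<iota> \<in> envs V"
      using asm by (auto simp: type_object_def dest: derivable_imp_judgement_in)
    have f1: "?f a \<in> above_one M" if "a \<in> above_one V" for a
      using that by (rule lax_map_above_one[OF M.comm_quantale_axioms V.comm_quantale_axioms lax])
    \<comment> \<open>Renaming stability concerns maps between elements above the unit, so
      \<open>h \<sigma>\<close> is restricted to them.\<close>
    then have "lax_map V (above_one V) M (above_one M) ?f"
      using lax by (simp add: lax_map_def V.above_one_closed Pi_iff)
    then have "derivable R M (Judgement (?f (qone V)) (?f \<circ> \<iota>) C (?f \<circ> \<Delta>))"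
      using asm M.comm_quantale_axioms V.comm_quantale_axioms unfolding renaming_stable_def
      by (simp del: o_apply)
    moreover have fenvs: "?f \<circ> \<Delta> \<in> envs M"
      using \<Delta> f1 by (simp add: envs_def)
    moreover have "qone M \<sqsubseteq>\<^bsub>M\<^esub> ?f (qone V)"
      using lax by (simp add: lax_map_def)
    moreover have "env_le M \<sigma> (?f \<circ> \<iota>)"
      using above by (simp add: env_le_def)
    \<comment> \<open>Weakening replaces the context \<open>?f (qone V)\<close> by the unit, using
      lax unitality, and the precondition \<open>?f \<circ> \<iota>\<close> by \<sigma>, using the
      inequality required of a type object.\<close>
    ultimately have "derivable R M (Judgement (qone M) \<sigma> C (?f \<circ> \<Delta>))"
      using asm M.comm_quantale_axioms \<sigma> M.env_le_refl[OF fenvs] M.above_one_qone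
      unfolding admits_sub_def by blast
    then have "(\<Otimes>\<^bsub>tmon M\<^esub>w\<in>W. ?f (\<Delta> w)) \<in> joint_bounds R M C \<sigma> W"
      unfolding joint_bounds_def by (intro CollectI exI[of _ "?f \<circ> \<Delta>"] conjI) (simp_all add: o_def)
    moreover have B: "joint_bounds R M C \<sigma> W \<subseteq> carrier M"
      by (rule M.joint_bounds_closed)
    ultimately have "\<Sqinter>\<^bsub>M\<^esub>(joint_bounds R M C \<sigma> W) \<sqsubseteq>\<^bsub>M\<^esub> (\<Otimes>\<^bsub>tmon M\<^esub>w\<in>W. ?f (\<Delta> w))"
      by (intro M.lat.weak.inf_lower)
    moreover have "(\<Otimes>\<^bsub>tmon M\<^esub>w\<in>W. ?f (\<Delta> w)) \<sqsubseteq>\<^bsub>M\<^esub> ?f (\<Otimes>\<^bsub>tmon V\<^esub>w\<in>W. \<Delta> w)"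
      using M.comm_quantale_axioms V.comm_quantale_axioms lax finite[of W] \<Delta>
      by (intro lax_map_finprod) (simp_all add: V.envs_closed)
    ultimately show "\<Sqinter>\<^bsub>M\<^esub>(joint_bounds R M C \<sigma> W) \<sqsubseteq>\<^bsub>M\<^esub> ?f (\<Otimes>\<^bsub>tmon V\<^esub>w\<in>W. \<Delta> w)"
      by (rule M.le_trans)
        (use B lax \<Delta> fenvs in \<open>auto simp: lax_map_def Pi_iff V.envs_closed\<close>)
  next
    assume R: "R = F1 fv"
    interpret \<alpha>: quantale_hom "UNat :: ('v \<Rightarrow> nat) set quantale" M "alphaN M \<sigma>"
      using \<sigma> by (rule M.quantale_hom_alphaN)
    \<comment> \<open>Each generator is the principal downset of a unit vector, whose monomial is
      the single factor \<open>\<sigma> v\<close>.\<close>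
    have gen: "alphaN M \<sigma> \<circ> gen = \<sigma>"
      using \<sigma> by (simp add: fun_eq_iff gen_def M.alphaN_down M.monomial_unit del: One_nat_def)
    \<comment> \<open>\<open>DeltaN\<close> is \<open>post\<close> started from the unit and the
      generators, and evaluation sends these to the unit of \<open>M\<close> and to
      \<sigma>.\<close>
    have "alphaN M \<sigma> \<circ> DeltaN fv C = post fv M C (qone M) \<sigma>"
      unfolding DeltaN_def using \<alpha>.hom_post[OF \<alpha>.A.above_one_qone gen_envs, of fv C]
      by (simp add: gen \<alpha>.hom_one)
    moreover have "DeltaN fv C \<in> envs UNat"
      unfolding DeltaN_def using \<alpha>.A.post_envs[OF \<alpha>.A.above_one_qone gen_envs] by simp
    ultimately have "alphaN M \<sigma> (JN fv C W) = (\<Otimes>\<^bsub>tmon M\<^esub>w\<in>W. post fv M C (qone M) \<sigma> w)"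
      unfolding JN_def by (simp add: \<alpha>.hom_finprod \<alpha>.A.envs_closed)
    then show "\<Sqinter>\<^bsub>M\<^esub>(joint_bounds R M C \<sigma> W) = alphaN M \<sigma> (JN fv C W)"
      using M.Inf_joint_bounds_F1[OF \<sigma>] by (simp add: R)
  qed
qed

end
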